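(* Every graph $G$ with maximum degree at most $4$ is proper conflict-free $(\mathrm{degree}+3)$-choosable. In particular, every graph with maximum degree at most $4$ is proper conflict-free $7$-choosable.
   Context: All graphs are simple, finite and undirected. $d_G(v)$ denotes the degree of $v$ in $G$. Given a graph $G$ and a mapping $f:V(G)\to\mathbb{N}$, an $f$-list assignment of $G$ is a function $L$ that maps each $v\in V(G)$ to a set $L(v)$ of at least $f(v)$ colors. For an $f$-list assignment $L$, a proper conflict-free $L$-coloring of $G$ is a coloring $\phi$ of $V(G)$ such that (i) $\phi(v)\in L(v)$ for every $v\in V(G)$, (ii) $\phi$ is proper, i.e. adjacent vertices receive distinct colors, and (iii) for every non-isolated vertex $v\in V(G)$ there is a color that appears exactly once in the neighborhood of $v$ (i.e. is assigned to exactly one neighbor of $v$). $G$ is proper conflict-free $f$-choosable if for every $f$-list assignment $L$ of $G$ there exists a proper conflict-free $L$-coloring of $G$. For a non-negative integer $k$, $G$ is proper conflict-free $(\mathrm{degree}+k)$-choosable if $G$ is proper conflict-free $f$-choosable for the mapping $f(v)=d_G(v)+k$ for every $v\in V(G)$; and $G$ is proper conflict-free $k$-choosable if $G$ is proper conflict-free $f$-choosable for the constant mapping $f(v)=k$. *)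

theory Defs
  imports Main
begin

definition simple_graph :: "'a set \<Rightarrow> 'a set set \<Rightarrow> bool" where
  "simple_graph V E \<longleftrightarrow> finite V \<and> (\<forall>e\<in>E. e \<subseteq> V \<and> card e = 2)"

definition neighborhood :: "'a set set \<Rightarrow> 'a \<Rightarrow> 'a set" where
  "neighborhood E v = {w. {v, w} \<in> E}"

definition degree :: "'a set set \<Rightarrow> 'a \<Rightarrow> nat" where
  "degree E v = card (neighborhood E v)"

(* The inserted 0 only fixes the value for the graph without vertices. *)
definition max_degree :: "'a set \<Rightarrow> 'a set set \<Rightarrow> nat" where
  "max_degree V E = Max (insert 0 (degree E ` V))"

(* Infinite lists are allowed; they need a separate case because card is 0 on infinite sets. *)
definition list_assignment :: "'a set \<Rightarrow> ('a \<Rightarrow> nat) \<Rightarrow> ('a \<Rightarrow> 'c set) \<Rightarrow> bool" where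
  "list_assignment V f L \<longleftrightarrow> (\<forall>v\<in>V. infinite (L v) \<or> f v \<le> card (L v))"

definition pcf_coloring ::
    "'a set \<Rightarrow> 'a set set \<Rightarrow> ('a \<Rightarrow> 'c set) \<Rightarrow> ('a \<Rightarrow> 'c) \<Rightarrow> bool" where
  "pcf_coloring V E L \<phi> \<longleftrightarrow>
     (\<forall>v\<in>V. \<phi> v \<in> L v) \<and>
     (\<forall>u\<in>V. \<forall>v\<in>V. {u, v} \<in> E \<longrightarrow> \<phi> u \<noteq> \<phi> v) \<and>
     (\<forall>v\<in>V. neighborhood E v \<noteq> {} \<longrightarrow>
        (\<exists>c. \<exists>!w. w \<in> neighborhood E v \<and> \<phi> w = c))"

(* The type argument is the type of colors, over whose lists the definition quantifies. *)
definition pcf_choosable ::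
    "'c itself \<Rightarrow> 'a set \<Rightarrow> 'a set set \<Rightarrow> ('a \<Rightarrow> nat) \<Rightarrow> bool" where
  "pcf_choosable (_ :: 'c itself) V E f \<longleftrightarrow>
     (\<forall>L :: 'a \<Rightarrow> 'c set. list_assignment V f L \<longrightarrow> (\<exists>\<phi>. pcf_coloring V E L \<phi>))"

definition pcf_degree_plus_choosable ::
    "'c itself \<Rightarrow> 'a set \<Rightarrow> 'a set set \<Rightarrow> nat \<Rightarrow> bool" where
  "pcf_degree_plus_choosable C V E k \<longleftrightarrow> pcf_choosable C V E (\<lambda>v. degree E v + k)"

definition pcf_const_choosable ::
    "'c itself \<Rightarrow> 'a set \<Rightarrow> 'a set set \<Rightarrow> nat \<Rightarrow> bool" where
  "pcf_const_choosable C V E k \<longleftrightarrow> pcf_choosable C V E (\<lambda>_. k)"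

end

(* Colour a component greedily towards a small connected set S, so that every vertex coloured outside S still has an
   uncoloured neighbour x; since x also keeps an uncoloured neighbour, a vertex of degree d meets at most d - 1 colours of
   neighbours and d - 1 colours that would spoil the neighbourhood of a neighbour, and 2(d - 1) < d + 3 because d \<le> 4.

   S is a triangle, otherwise a 4-cycle, otherwise an edge vr. For triangles and 4-cycles the extension is a finite list
   colouring problem. For an edge, a neighbourhood that forbids a colour at its last vertex shows at most two colours,
   which frees a colour elsewhere. So if some neighbour x of v (or of r) has two admissible colours, then the neighbours
   of v are recoloured after the colours of v and r have been fixed; otherwise no neighbour of v or r forbids a colour, and
   v and r have four colours each to choose from. *)
theory Submission
  imports Defs
begin

section \<open>List colourings of triangles and 4-cycles\<close>

text \<open>A coloured neighbour costs a vertex of \<open>S\<close> up to two colours: its own, and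
  one that its neighbourhood rules out. On a short cycle a vertex of degree 4 has only two
  neighbours outside \<open>S\<close>, so at least three of its seven colours survive, and the
  remaining question depends only on lists and on the colours seen outside the cycle. At an end of
  an edge there are three outer neighbours, and possibly a single colour survives, while the
  neighbourhoods of both ends are still to be made conflict-free. The outer colours can then no
  longer be taken as given, and neighbours of one end have to be recoloured. This is safe if they
  are pairwise nonadjacent and no other vertex sees two of them, which is exactly the absence of
  triangles and 4-cycles. Hence the short cycles are treated separately. The 4-cycle is the delicate
  one: opposite vertices may have to share a colour, and an outer vertex adjacent to both may
  prohibit just that, but such a vertex then rules out no colour, and the list grows by one.\<close>

lemma ex_notin_of_card_less:
  assumes "finite B" "card B < card A"
  shows "\<exists>x\<in>A. x \<notin> B"
  using assms by (meson card_mono not_le subsetI)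

lemma ex_avoid1: "2 \<le> card A \<Longrightarrow> \<exists>x\<in>A. x \<noteq> p"
  using ex_notin_of_card_less[of "{p}" A] by auto

lemma ex_avoid2: "3 \<le> card A \<Longrightarrow> \<exists>x\<in>A. x \<noteq> p \<and> x \<noteq> q"
  using ex_notin_of_card_less[of "{p, q}" A] card_insert_le_m1[of 2 "{q}" p] by auto

lemma ex_avoid3: "4 \<le> card A \<Longrightarrow> \<exists>x\<in>A. x \<noteq> p \<and> x \<noteq> q \<and> x \<noteq> r"
  using ex_notin_of_card_less[of "{p, q, r}" A] card_insert_le_m1[of 3 "{q, r}" p]
    card_insert_le_m1[of 2 "{r}" q] by auto

lemma ex_avoid4: "5 \<le> card A \<Longrightarrow> \<exists>x\<in>A. x \<noteq> p \<and> x \<noteq> q \<and> x \<noteq> r \<and> x \<noteq> s"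
  using ex_notin_of_card_less[of "{p, q, r, s}" A] card_insert_le_m1[of 4 "{q, r, s}" p]
    card_insert_le_m1[of 3 "{r, s}" q] card_insert_le_m1[of 2 "{s}" r] by auto

text \<open>A pair that contains \<open>b\<close> is determined by its other member, so a condition
  of the form \<open>{x, b} \<noteq> Q\<close> costs at most one colour for
  \<open>x\<close>.\<close>

lemma ex_mate: "\<exists>m. \<forall>x. x \<noteq> m \<longrightarrow> {x, b} \<noteq> Q"
  by (metis doubleton_eq_iff)

lemma ex_mate': "\<exists>m. \<forall>x. x \<noteq> m \<longrightarrow> {b, x} \<noteq> Q"
  by (metis doubleton_eq_iff)

lemma card_Diff_ge: "finite B \<Longrightarrow> card B \<le> k \<Longrightarrow> n + k \<le> card A \<Longrightarrow> n \<le> card (A - B)"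
  using diff_card_le_card_Diff[of B A] by linarith

lemma card_2_cases: "2 \<le> card A \<Longrightarrow> \<exists>x y. x \<in> A \<and> y \<in> A \<and> x \<noteq> y"
  by (metis One_nat_def Suc_1 card.infinite card_le_Suc0_iff_eq not_less_eq_eq zero_le)

text \<open>If every pair of distinct colours from the two lists equals \<open>Q\<close>, then
  \<open>Q\<close> has two elements. It contains each colour of either list, because the other list
  offers a colour different from it.\<close>

lemma ex_pair_distinct:
  assumes "2 \<le> card B" "2 \<le> card C"
  shows "(\<exists>b\<in>B. \<exists>c\<in>C. b \<noteq> c \<and> {b, c} \<noteq> Q) \<or> B = C \<and> C = Q \<and> card Q = 2"
proof (rule disjCI)
  assume n: "\<not> (B = C \<and> C = Q \<and> card Q = 2)"
  obtain b b' where b: "b \<in> B" "b' \<in> B" "b \<noteq> b'" using card_2_cases[OF assms(1)] by blast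
  obtain c c' where c: "c \<in> C" "c' \<in> C" "c \<noteq> c'" using card_2_cases[OF assms(2)] by blast
  show "\<exists>b\<in>B. \<exists>c\<in>C. b \<noteq> c \<and> {b, c} \<noteq> Q"
  proof (rule ccontr)
    assume "\<not> ?thesis"
    then have q: "\<And>x y. x \<in> B \<Longrightarrow> y \<in> C \<Longrightarrow> x \<noteq> y \<Longrightarrow> {x, y} = Q" by blast
    have "\<exists>m n. m \<noteq> n \<and> Q = {m, n}" using q b c by metis
    then obtain m n where mn: "m \<noteq> n" "Q = {m, n}" by blast
    have "B \<subseteq> Q" using q c by (metis insertI1 mn subsetI)
    have "C \<subseteq> Q" using q b by (metis insertI1 insert_commute mn subsetI)
    have "card Q = 2" using mn by simp
    have "B = Q" using \<open>B \<subseteq> Q\<close> assms \<open>card Q = 2\<close> mn by (simp add: card_seteq)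
    moreover have "C = Q" using \<open>C \<subseteq> Q\<close> assms \<open>card Q = 2\<close> mn by (simp add: card_seteq)
    ultimately show False using n \<open>card Q = 2\<close> by auto
  qed
qed

section \<open>Colouring a triangle from lists\<close>

lemma triangle_lists_free:
  assumes "3 \<le> card Ra" "3 \<le> card Rb" "3 \<le> card Rc"
    and "Ra \<inter> Qa = {}" "Rb \<inter> Qb = {}" "Rc \<inter> Qc = {}"
    and x: "x \<in> Ra" "x \<notin> Qb" "x \<notin> Qc"
  shows "\<exists>a\<in>Ra. \<exists>b\<in>Rb. \<exists>c\<in>Rc. a \<noteq> b \<and> b \<noteq> c \<and> c \<noteq> a \<and> {b, c} \<noteq> Qa \<and> {a, c} \<noteq> Qb \<and> {a, b} \<noteq> Qc"
proof -
  \<comment> \<open>With \<open>x\<close> on the first vertex the conditions on \<open>Qb\<close>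
    and \<open>Qc\<close> hold whatever the other colours are, so only \<open>Qa\<close> is
    left.\<close>
  have "2 \<le> card (Rb - {x})" "2 \<le> card (Rc - {x})"
    using assms(2,3) card_Diff_ge[of "{x}" 1 2] by auto
  from ex_pair_distinct[OF this, of Qa] show ?thesis
  proof (elim disjE)
    assume "\<exists>b\<in>Rb - {x}. \<exists>c\<in>Rc - {x}. b \<noteq> c \<and> {b, c} \<noteq> Qa"
    then show ?thesis using x by (metis DiffD1 DiffD2 insertI1 singletonI)
  next
    assume h: "Rb - {x} = Rc - {x} \<and> Rc - {x} = Qa \<and> card Qa = 2"
    have "x \<in> Rb"
    proof (rule ccontr)
      assume "x \<notin> Rb"
      then have "Rb = Qa" using h by auto
      then show False using h assms(2) by simp
    qed
    have "x \<in> Rc"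
    proof (rule ccontr)
      assume "x \<notin> Rc"
      then have "Rc = Qa" using h by auto
      then show False using h assms(3) by simp
    qed
    obtain m where m: "m \<in> Qa" using h by (metis card.empty ex_in_conv zero_neq_numeral)
    have mm: "m \<in> Rb" "m \<in> Rc" "m \<noteq> x" using m h by blast+
    \<comment> \<open>Here \<open>Rb\<close> and \<open>Rc\<close> are both \<open>Qa\<close> with
      \<open>x\<close> added. Another colour \<open>y\<close> of \<open>Ra\<close> lies in neither,
      because \<open>Ra\<close> misses \<open>Qa\<close>. The pair \<open>{m, x}\<close> is not
      \<open>Qa\<close>, and \<open>m\<close> and \<open>x\<close> are outside \<open>Qb\<close> and
      \<open>Qc\<close> as members of \<open>Rb\<close> and \<open>Rc\<close>.\<close>
    obtain y where y: "y \<in> Ra" "y \<noteq> x" using ex_avoid1[of Ra x] assms(1) by force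
    have yn: "y \<notin> Rb" "y \<notin> Rc" using y h assms(4) by blast+
    have "{m, x} \<noteq> Qa" using h by blast
    moreover have "{y, x} \<noteq> Qb" "{y, x} \<noteq> Qc" "{y, m} \<noteq> Qb" "{y, m} \<noteq> Qc" 
      using \<open>x \<in> Rb\<close> \<open>x \<in> Rc\<close> mm assms(5,6) by blast+
    ultimately show ?thesis using y yn mm \<open>x \<in> Rb\<close> \<open>x \<in> Rc\<close> by metis
  qed
qed

lemma triangle_lists:
  assumes "3 \<le> card Ra" "3 \<le> card Rb" "3 \<le> card Rc"
    and "Ra \<inter> Qa = {}" "Rb \<inter> Qb = {}" "Rc \<inter> Qc = {}"
    and "finite Qa" "finite Qb" "finite Qc" "card Qa \<le> 2" "card Qb \<le> 2" "card Qc \<le> 2"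
  shows "\<exists>a\<in>Ra. \<exists>b\<in>Rb. \<exists>c\<in>Rc. a \<noteq> b \<and> b \<noteq> c \<and> c \<noteq> a \<and> {b, c} \<noteq> Qa \<and> {a, c} \<noteq> Qb \<and> {a, b} \<noteq> Qc"
proof -
  consider (a) x where "x \<in> Ra" "x \<notin> Qb" "x \<notin> Qc" | (b) x where "x \<in> Rb" "x \<notin> Qc" "x \<notin> Qa"
    | (c) x where "x \<in> Rc" "x \<notin> Qa" "x \<notin> Qb"
    | (n) "Ra \<subseteq> Qb \<union> Qc" "Rb \<subseteq> Qc \<union> Qa" "Rc \<subseteq> Qa \<union> Qb" by blast
  then show ?thesis
  proof cases
    case a then show ?thesis using triangle_lists_free[of Ra Rb Rc Qa Qb Qc x] assms by blast
  next
    case b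
    then obtain b c a where "b \<in> Rb" "c \<in> Rc" "a \<in> Ra" "b \<noteq> c" "c \<noteq> a" "a \<noteq> b" "{c, a} \<noteq> Qb" "{b, a} \<noteq> Qc" "{b, c} \<noteq> Qa"
      using triangle_lists_free[of Rb Rc Ra Qb Qc Qa x] assms by blast
    then show ?thesis by (auto simp: insert_commute)
  next
    case c
    then obtain b c a where "b \<in> Rb" "c \<in> Rc" "a \<in> Ra" "b \<noteq> c" "c \<noteq> a" "a \<noteq> b" "{a, b} \<noteq> Qc" "{c, b} \<noteq> Qa" "{c, a} \<noteq> Qb"
      using triangle_lists_free[of Rc Ra Rb Qc Qa Qb x] assms by blast
    then show ?thesis by (auto simp: insert_commute)
  next
    case n
    \<comment> \<open>Now \<open>a\<close>, lying outside \<open>Qc\<close>, must lie in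
      \<open>Qb\<close>, which is disjoint from \<open>Rb\<close>; so it differs from every choice
      of \<open>b\<close>. The same holds cyclically.\<close>
    obtain a where a: "a \<in> Ra" "a \<notin> Qc" using ex_notin_of_card_less[of Qc Ra] assms by auto
    obtain b where b: "b \<in> Rb" "b \<notin> Qa" using ex_notin_of_card_less[of Qa Rb] assms by auto
    obtain c where c: "c \<in> Rc" "c \<notin> Qb" using ex_notin_of_card_less[of Qb Rc] assms by auto
    have "a \<noteq> b" "b \<noteq> c" "c \<noteq> a" using a b c n assms(4-6) by blast+
    moreover have "{b, c} \<noteq> Qa" "{a, c} \<noteq> Qb" "{a, b} \<noteq> Qc" using a b c by blast+
    ultimately show ?thesis using a b c by blast
  qed
qed

section \<open>Colouring a chordless 4-cycle from lists\<close>

text \<open>Colours \<open>a\<close>, \<open>b\<close>, \<open>c\<close>, \<open>d\<close> of a chordless 4-cycle. The set \<open>Qa\<close> holds the colours of the at most two outer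
  neighbours of the first vertex: \<open>{b, d} \<noteq> Qa\<close> makes its neighbourhood conflict-free if they have two colours, and
  \<open>b \<noteq> d\<close> does otherwise. The flags \<open>f\<close>, \<open>g\<close> record an outer vertex that is adjacent to two opposite vertices and
  needs distinct colours there.\<close>

definition quad_ok :: "'c \<Rightarrow> 'c \<Rightarrow> 'c \<Rightarrow> 'c \<Rightarrow> 'c set \<Rightarrow> 'c set \<Rightarrow> 'c set \<Rightarrow> 'c set \<Rightarrow> bool \<Rightarrow> bool \<Rightarrow> bool" where
  "quad_ok a b c d Qa Qb Qc Qd f g \<longleftrightarrow>
     a \<noteq> b \<and> b \<noteq> c \<and> c \<noteq> d \<and> d \<noteq> a \<and>
     (f \<or> card Qb \<le> 1 \<or> card Qd \<le> 1 \<longrightarrow> a \<noteq> c) \<and> (g \<or> card Qa \<le> 1 \<or> card Qc \<le> 1 \<longrightarrow> b \<noteq> d) \<and>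
     {b, d} \<noteq> Qa \<and> {b, d} \<noteq> Qc \<and> {a, c} \<noteq> Qb \<and> {a, c} \<noteq> Qd"

lemma quad_ok_rotate: "quad_ok a b c d Qa Qb Qc Qd f g \<Longrightarrow> quad_ok b c d a Qb Qc Qd Qa g f"
  unfolding quad_ok_def insert_commute[of c a "{}"] by blast

lemma quad_ok_reflect: "quad_ok a b c d Qa Qb Qc Qd f g \<Longrightarrow> quad_ok c b a d Qc Qb Qa Qd f g"
  unfolding quad_ok_def insert_commute[of c a "{}"] by blast

text \<open>Disjoint lists of size 2 contain three different unordered pairs, one of which avoids
  \<open>P\<close> and \<open>Q\<close>. A common colour gives a singleton, which is no two-element
  set.\<close>

lemma ex_pair_avoid2:
  assumes "2 \<le> card B" "2 \<le> card C" "B \<inter> C = {} \<or> card P = 2 \<and> card Q = 2"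
  shows "\<exists>b\<in>B. \<exists>c\<in>C. {b, c} \<noteq> P \<and> {b, c} \<noteq> Q"
proof (cases "B \<inter> C = {}")
  case True
  obtain b b' where b: "b \<in> B" "b' \<in> B" "b \<noteq> b'" using card_2_cases[OF assms(1)] by blast
  obtain c c' where c: "c \<in> C" "c' \<in> C" "c \<noteq> c'" using card_2_cases[OF assms(2)] by blast
  have "b \<noteq> c" "b \<noteq> c'" "b' \<noteq> c" "b' \<noteq> c'" using True b c by auto
  then have "{b, c} \<noteq> {b', c}" "{b, c} \<noteq> {b, c'}" "{b, c'} \<noteq> {b', c}"
    using b c by (auto simp: doubleton_eq_iff)
  then show ?thesis using b c by metis
next
  case False
  then obtain x where "x \<in> B" "x \<in> C" by blast
  moreover have "{x, x} \<noteq> P" "{x, x} \<noteq> Q" using False assms(3) by auto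
  ultimately show ?thesis by blast
qed

lemma ex_pair_distinct_avoid2:
  assumes "3 \<le> card B" "3 \<le> card C" "finite P" "card P \<le> 2"
  shows "\<exists>b\<in>B. \<exists>c\<in>C. b \<noteq> c \<and> {b, c} \<noteq> P \<and> {b, c} \<noteq> Q"
proof -
  obtain b where b: "b \<in> B" "b \<notin> P" using ex_notin_of_card_less[of P B] assms by auto
  obtain m where m: "\<And>x. x \<noteq> m \<Longrightarrow> {b, x} \<noteq> Q" using ex_mate' by metis
  obtain c where "c \<in> C" "c \<noteq> b" "c \<noteq> m" using ex_avoid2[of C b m] assms by auto
  then show ?thesis using b m by (metis insertI1)
qed

text \<open>If one list contains both \<open>a\<close> and \<open>c\<close>, the other contains
  neither: a colour left in the first has at most one partner in each of \<open>P\<close> and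
  \<open>Q\<close>, and three colours of the other list suffice. Otherwise each list loses at most
  one colour, and two disjoint lists of size 2 remain.\<close>

lemma ex_pair_disjoint_avoid:
  assumes "3 \<le> card B" "3 \<le> card D" "B \<inter> D = {}"
  shows "\<exists>b\<in>B. \<exists>d\<in>D. b \<noteq> a \<and> b \<noteq> c \<and> d \<noteq> a \<and> d \<noteq> c \<and> {b, d} \<noteq> P \<and> {b, d} \<noteq> Q"
proof -
  consider (b) "a \<in> B" "c \<in> B" | (d) "a \<in> D" "c \<in> D" | (n) "a \<notin> B \<or> c \<notin> B" "a \<notin> D \<or> c \<notin> D" by blast
  then show ?thesis
  proof cases
    case b
    obtain x where x: "x \<in> B" "x \<noteq> a" "x \<noteq> c" using ex_avoid2[of B a c] assms by auto
    obtain m where m: "\<And>y. y \<noteq> m \<Longrightarrow> {x, y} \<noteq> P" using ex_mate' by metis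
    obtain n where n: "\<And>y. y \<noteq> n \<Longrightarrow> {x, y} \<noteq> Q" using ex_mate' by metis
    obtain y where y: "y \<in> D" "y \<noteq> m" "y \<noteq> n" using ex_avoid2[of D m n] assms by auto
    then have "y \<noteq> a" "y \<noteq> c" using b assms(3) by auto
    then show ?thesis using x y m n by metis
  next
    case d
    obtain x where x: "x \<in> D" "x \<noteq> a" "x \<noteq> c" using ex_avoid2[of D a c] assms by auto
    obtain m where m: "\<And>y. y \<noteq> m \<Longrightarrow> {y, x} \<noteq> P" using ex_mate by metis
    obtain n where n: "\<And>y. y \<noteq> n \<Longrightarrow> {y, x} \<noteq> Q" using ex_mate by metis
    obtain y where y: "y \<in> B" "y \<noteq> m" "y \<noteq> n" using ex_avoid2[of B m n] assms by auto
    then have "y \<noteq> a" "y \<noteq> c" using d assms(3) by auto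
    then show ?thesis using x y m n by metis
  next
    case n
    have e: "2 \<le> card (X - {a, c})" if "a \<notin> X \<or> c \<notin> X" "3 \<le> card X" for X
    proof -
      have "X - {a, c} = X - {a} \<or> X - {a, c} = X - {c}" using that by auto
      moreover have "2 \<le> card (X - {a})" "2 \<le> card (X - {c})"
        using that(2) card_Diff_ge[of "{a}" 1 2 X] card_Diff_ge[of "{c}" 1 2 X] by auto
      ultimately show ?thesis by metis
    qed
    have "\<exists>b\<in>B - {a, c}. \<exists>d\<in>D - {a, c}. {b, d} \<noteq> P \<and> {b, d} \<noteq> Q"
      using n e assms by (intro ex_pair_avoid2) auto
    then show ?thesis by blast
  qed
qed

lemma quad_lists_disjoint:
  assumes "3 \<le> card Ra" "3 \<le> card Rb" "3 \<le> card Rc" "3 \<le> card Rd"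
    and "Rb \<inter> Rd = {}" "finite Qb" "card Qb \<le> 2"
  shows "\<exists>a\<in>Ra. \<exists>b\<in>Rb. \<exists>c\<in>Rc. \<exists>d\<in>Rd. quad_ok a b c d Qa Qb Qc Qd f g"
proof -
  obtain a c where ac: "a \<in> Ra" "c \<in> Rc" "a \<noteq> c" "{a, c} \<noteq> Qb" "{a, c} \<noteq> Qd"
    using ex_pair_distinct_avoid2[of Ra Rc Qb Qd] assms by auto
  obtain b d where "b \<in> Rb" "d \<in> Rd" "b \<noteq> a" "b \<noteq> c" "d \<noteq> a" "d \<noteq> c" "{b, d} \<noteq> Qa" "{b, d} \<noteq> Qc"
    using ex_pair_disjoint_avoid[of Rb Rd a c Qa Qc] assms by blast
  moreover from this have "b \<noteq> d" using assms(5) by blast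
  ultimately have "quad_ok a b c d Qa Qb Qc Qd f g" unfolding quad_ok_def using ac by simp
  then show ?thesis using \<open>b \<in> Rb\<close> \<open>d \<in> Rd\<close> ac by blast
qed

text \<open>This is the exception that arises if \<open>x\<close> is given to two opposite vertices:
  the other two lists shrink to \<open>Qc\<close>. The way out is \<open>x\<close> on the fourth
  vertex and a colour of \<open>Qc\<close> on the second, whose pair differs from \<open>Qc\<close>
  because \<open>x\<close> is not in it.\<close>

lemma quad_lists_tight:
  assumes "4 \<le> card Ra" "3 \<le> card Rc" "Rb = insert x Qc" "Rd = insert x Qc" "x \<notin> Qc" "card Qc = 2"
    and "x \<in> Ra" "x \<in> Rc" "Rc \<inter> Qc = {}" "Rb \<inter> Qb = {}" "Rd \<inter> Qd = {}"
    and "card Qb = 2" "card Qd = 2" "card Qa \<le> 1"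
  shows "\<exists>a\<in>Ra. \<exists>b\<in>Rb. \<exists>c\<in>Rc. \<exists>d\<in>Rd. quad_ok a b c d Qa Qb Qc Qd False g"
proof -
  obtain y where y: "y \<in> Rc" "y \<noteq> x" using ex_avoid1[of Rc x] assms by auto
  obtain m n where mn: "Qc = {m, n}" "m \<noteq> n" using assms(6) by (metis card_2_iff)
  have yn: "y \<noteq> m" "y \<noteq> n" "m \<noteq> x" "n \<noteq> x" using y mn assms by auto
  have Qa: "{p, q} \<noteq> Qa" if "p \<noteq> q" for p q using that assms(14) by auto
  have bd: "Qb \<inter> {x, m, n} = {}" "Qd \<inter> {x, m, n} = {}" using assms mn by auto
  show ?thesis
  proof (cases "m \<in> Ra \<or> n \<in> Ra")
    case True
    \<comment> \<open>The two colours of \<open>Qc\<close> go to the first two vertices. As a member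
      of \<open>Rb\<close> and \<open>Rd\<close>, the colour \<open>a\<close> lies in neither
      \<open>Qb\<close> nor \<open>Qd\<close>.\<close>
    then obtain a b where ab: "a \<in> Ra" "{a, b} = Qc" "a \<noteq> b" using mn by (metis insert_commute)
    have "quad_ok a b y x Qa Qb Qc Qd False g"
      unfolding quad_ok_def using ab y yn Qa bd mn assms by (auto simp: doubleton_eq_iff)
    then show ?thesis using ab y assms by blast
  next
    case False
    obtain p where p: "\<And>x. x \<noteq> p \<Longrightarrow> {x, y} \<noteq> Qb" using ex_mate by metis
    obtain q where q: "\<And>x. x \<noteq> q \<Longrightarrow> {x, y} \<noteq> Qd" using ex_mate by metis
    obtain a where a: "a \<in> Ra" "a \<noteq> x" "a \<noteq> p" "a \<noteq> q" using ex_avoid3[of Ra x p q] assms by auto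
    have "quad_ok a m y x Qa Qb Qc Qd False g"
      unfolding quad_ok_def using a y yn Qa bd mn assms False p q by (auto simp: doubleton_eq_iff)
    then show ?thesis using a y mn assms by blast
  qed
qed

text \<open>Two opposite vertices may share the colour \<open>x\<close> here: no flag demands that
  they differ, and the singleton \<open>{x}\<close> is neither \<open>Qb\<close> nor
  \<open>Qd\<close>. Only the other two lists lose a colour.\<close>

lemma quad_lists_common:
  assumes "5 - card Qa \<le> card Ra" "5 - card Qc \<le> card Rc" 
    and "(if g then 4 else 3) \<le> card Rb" "(if g then 4 else 3) \<le> card Rd"
    and "Ra \<inter> Qa = {}" "Rb \<inter> Qb = {}" "Rc \<inter> Qc = {}" "Rd \<inter> Qd = {}"
    and "card Qa \<le> 2" "card Qb = 2" "card Qc \<le> 2" "card Qd = 2" "finite Qa"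
    and x: "x \<in> Ra" "x \<in> Rc"
  shows "\<exists>a\<in>Ra. \<exists>b\<in>Rb. \<exists>c\<in>Rc. \<exists>d\<in>Rd. quad_ok a b c d Qa Qb Qc Qd False g"
proof -
  have x2: "{x, x} \<noteq> Qb" "{x, x} \<noteq> Qd" using assms by auto
  have ge: "3 \<le> card Ra" "3 \<le> card Rc" "3 \<le> card Rb" "3 \<le> card Rd" using assms by (auto split: if_splits)
  have Q1: "{p, q} \<noteq> Q" if "p \<noteq> q" "card Q \<le> 1" for p q and Q :: "'a set" using that by auto
  have BD: "2 \<le> card (Rb - {x})" "2 \<le> card (Rd - {x})" using ge card_Diff_ge[of "{x}" 1 2] by auto
  have fin: "\<exists>a\<in>Ra. \<exists>b\<in>Rb. \<exists>c\<in>Rc. \<exists>d\<in>Rd. quad_ok a b c d Qa Qb Qc Qd False g"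
    if "b \<in> Rb - {x}" "d \<in> Rd - {x}" "g \<or> card Qa \<le> 1 \<or> card Qc \<le> 1 \<longrightarrow> b \<noteq> d" "{b, d} \<noteq> Qa" "{b, d} \<noteq> Qc" for b d
  proof -
    have "quad_ok x b x d Qa Qb Qc Qd False g"
      unfolding quad_ok_def using that x2 assms(10,12) by simp blast
    then show ?thesis using that x by blast
  qed
  consider (n) "\<not> g" "card Qa = 2" "card Qc = 2" | (g) "g" | (ac) "card Qa \<le> 1" "card Qc \<le> 1"
    | (a) "card Qa \<le> 1" "card Qc = 2" | (c) "card Qa = 2" "card Qc \<le> 1" using assms(9,11) by linarith
  then show ?thesis
  proof cases
    case n
    then show ?thesis using ex_pair_avoid2[OF BD, of Qa Qc] fin by auto
  next
    case g
    have "3 \<le> card (Rb - {x})" "3 \<le> card (Rd - {x})" using g assms(3,4) card_Diff_ge[of "{x}" 1 3] by auto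
    then show ?thesis using ex_pair_distinct_avoid2[of "Rb - {x}" "Rd - {x}" Qa Qc] fin assms by metis
  next
    case ac
    obtain b where "b \<in> Rb - {x}" using card_2_cases[OF BD(1)] by blast
    moreover obtain d where "d \<in> Rd - {x}" "d \<noteq> b" using BD ex_avoid1 by metis
    ultimately show ?thesis using fin ac Q1 by metis
  next
    case a
    from ex_pair_distinct[OF BD, of Qc] show ?thesis
    proof (elim disjE)
      assume "\<exists>b\<in>Rb - {x}. \<exists>c\<in>Rd - {x}. b \<noteq> c \<and> {b, c} \<noteq> Qc"
      then show ?thesis using fin Q1 a by metis
    next
      assume h: "Rb - {x} = Rd - {x} \<and> Rd - {x} = Qc \<and> card Qc = 2"
      have "x \<in> R" if "3 \<le> card R" "R - {x} = Qc" for R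
      proof (rule ccontr)
        assume "x \<notin> R"
        then have "R = Qc" using that by auto
        then show False using h that by simp
      qed
      then have "x \<in> Rb" "x \<in> Rd" using ge h by auto
      then have "Rb = insert x Qc" "Rd = insert x Qc" using h by auto
      then show ?thesis using h a assms ge by (intro quad_lists_tight[of Ra Rc Rb x Qc Rd]) auto
    qed
  next
    case c
    from ex_pair_distinct[OF BD, of Qa] show ?thesis
    proof (elim disjE)
      assume "\<exists>b\<in>Rb - {x}. \<exists>c\<in>Rd - {x}. b \<noteq> c \<and> {b, c} \<noteq> Qa"
      then show ?thesis using fin Q1 c by metis
    next
      assume h: "Rb - {x} = Rd - {x} \<and> Rd - {x} = Qa \<and> card Qa = 2"
      have "x \<in> R" if "3 \<le> card R" "R - {x} = Qa" for R
      proof (rule ccontr)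
        assume "x \<notin> R"
        then have "R = Qa" using that by auto
        then show False using h that by simp
      qed
      then have "x \<in> Rb" "x \<in> Rd" using ge h by auto
      then have "Rb = insert x Qa" "Rd = insert x Qa" using h by auto
      then have "\<exists>c\<in>Rc. \<exists>b\<in>Rb. \<exists>a\<in>Ra. \<exists>d\<in>Rd. quad_ok c b a d Qc Qb Qa Qd False g"
        using h c assms ge by (intro quad_lists_tight[of Rc Ra Rb x Qa Rd]) auto
      then show ?thesis using quad_ok_reflect by metis
    qed
  qed
qed

text \<open>All four colours are chosen distinct, which settles \<open>Qa\<close> and
  \<open>Qb\<close> by size, and \<open>c\<close> outside \<open>Qd\<close> settles
  \<open>Qd\<close>. The condition on \<open>Qc\<close> costs \<open>b\<close> a third colour
  besides \<open>c\<close> and \<open>d\<close>.\<close>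

lemma quad_lists_4433:
  assumes "4 \<le> card Ra" "4 \<le> card Rb" "3 \<le> card Rc" "3 \<le> card Rd" 
    and "card Qa \<le> 1" "card Qb \<le> 1" "card Qd \<le> 2" "finite Qd"
  shows "\<exists>a\<in>Ra. \<exists>b\<in>Rb. \<exists>c\<in>Rc. \<exists>d\<in>Rd. quad_ok a b c d Qa Qb Qc Qd f g"
proof -
  have Q1: "{p, q} \<noteq> Q" if "p \<noteq> q" "card Q \<le> 1" for p q and Q :: "'a set" using that by auto
  obtain c where c: "c \<in> Rc" "c \<notin> Qd" using ex_notin_of_card_less[of Qd Rc] assms by auto
  obtain d where d: "d \<in> Rd" "d \<noteq> c" using ex_avoid1[of Rd c] assms by auto
  obtain m where m: "\<And>x. x \<noteq> m \<Longrightarrow> {x, d} \<noteq> Qc" using ex_mate by metis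
  obtain b where b: "b \<in> Rb" "b \<noteq> c" "b \<noteq> d" "b \<noteq> m" using ex_avoid3[of Rb c d m] assms by auto
  obtain a where a: "a \<in> Ra" "a \<noteq> b" "a \<noteq> c" "a \<noteq> d" using ex_avoid3[of Ra b c d] assms by auto
  have "quad_ok a b c d Qa Qb Qc Qd f g" unfolding quad_ok_def using a b c d m Q1 assms by auto
  then show ?thesis using a b c d by blast
qed

lemma quad_lists_5343:
  assumes "5 \<le> card Ra" "3 \<le> card Rb" "4 \<le> card Rc" "3 \<le> card Rd" 
    and "card Qa \<le> 1" "card Qc \<le> 2" "finite Qc"
  shows "\<exists>a\<in>Ra. \<exists>b\<in>Rb. \<exists>c\<in>Rc. \<exists>d\<in>Rd. quad_ok a b c d Qa Qb Qc Qd f g"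
proof -
  have Q1: "{p, q} \<noteq> Q" if "p \<noteq> q" "card Q \<le> 1" for p q and Q :: "'a set" using that by auto
  obtain b where b: "b \<in> Rb" "b \<notin> Qc" using ex_notin_of_card_less[of Qc Rb] assms by auto
  obtain d where d: "d \<in> Rd" "d \<noteq> b" using ex_avoid1[of Rd b] assms by auto
  obtain c where c: "c \<in> Rc" "c \<noteq> b" "c \<noteq> d" using ex_avoid2[of Rc b d] assms by auto
  obtain c' where c': "c' \<in> Rc" "c' \<noteq> b" "c' \<noteq> d" "c' \<noteq> c" using ex_avoid3[of Rc b d c] assms by auto
  \<comment> \<open>The five colours for \<open>a\<close> leave room for one partner besides
    \<open>b\<close>, \<open>c\<close>, \<open>d\<close>. The partners of \<open>c\<close> in
    \<open>Qb\<close> and \<open>Qd\<close> can differ only if \<open>c\<close> lies in both; then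
    \<open>c'\<close> has no possible partner except \<open>c\<close> in either of them.\<close>
  have "\<exists>c m. c \<in> Rc \<and> c \<noteq> b \<and> c \<noteq> d \<and> (\<forall>x. x \<noteq> m \<longrightarrow> {x, c} \<noteq> Qb \<and> {x, c} \<noteq> Qd)"
  proof (cases "Qb = Qd \<or> c \<notin> Qb \<or> c \<notin> Qd")
    case True
    then have "\<exists>m. \<forall>x. x \<noteq> m \<longrightarrow> {x, c} \<noteq> Qb \<and> {x, c} \<noteq> Qd" 
      using ex_mate[of c Qb] ex_mate[of c Qd] by (metis insertCI)
    then show ?thesis using c by blast
  next
    case False
    then have "\<exists>m. \<forall>x. x \<noteq> m \<longrightarrow> {x, c'} \<noteq> Qb \<and> {x, c'} \<noteq> Qd" using c'(4)
      by (metis doubleton_eq_iff insert_iff singletonD)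
    then show ?thesis using c' by blast
  qed
  then obtain c m where c: "c \<in> Rc" "c \<noteq> b" "c \<noteq> d" and m: "\<And>x. x \<noteq> m \<Longrightarrow> {x, c} \<noteq> Qb \<and> {x, c} \<noteq> Qd" by blast
  obtain a where a: "a \<in> Ra" "a \<noteq> b" "a \<noteq> c" "a \<noteq> d" "a \<noteq> m" using ex_avoid4[of Ra b c d m] assms by auto
  have "quad_ok a b c d Qa Qb Qc Qd f g" unfolding quad_ok_def using a b c d m Q1 assms by auto
  then show ?thesis using a b c d by blast
qed

text \<open>A colour \<open>a\<close> outside \<open>Qb\<close> and \<open>Qd\<close> settles both
  of their conditions, so \<open>c\<close> only has to differ from the three other colours.\<close>

lemma quad_lists_4444_free:
  assumes "4 \<le> card Rb" "4 \<le> card Rc" "4 \<le> card Rd" 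
    and "card Qc \<le> 2" "finite Qc" and a: "a \<in> Ra" "a \<notin> Qb" "a \<notin> Qd"
  shows "\<exists>a\<in>Ra. \<exists>b\<in>Rb. \<exists>c\<in>Rc. \<exists>d\<in>Rd. quad_ok a b c d Qa Qb Qc Qd f g"
proof -
  have "card (insert a Qc) \<le> 3" using assms(4,5) by (simp add: card_insert_if)
  then obtain b where b: "b \<in> Rb" "b \<notin> Qc" "b \<noteq> a" using ex_notin_of_card_less[of "insert a Qc" Rb] assms by auto
  obtain m where m: "\<And>x. x \<noteq> m \<Longrightarrow> {b, x} \<noteq> Qa" using ex_mate' by metis
  obtain d where d: "d \<in> Rd" "d \<noteq> a" "d \<noteq> b" "d \<noteq> m" using ex_avoid3[of Rd a b m] assms by auto
  obtain c where c: "c \<in> Rc" "c \<noteq> a" "c \<noteq> b" "c \<noteq> d" using ex_avoid3[of Rc a b d] assms by auto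
  have "quad_ok a b c d Qa Qb Qc Qd f g" unfolding quad_ok_def using a b c d m assms by auto
  then show ?thesis using a b c d by blast
qed

lemma quad_lists_4444:
  assumes "4 \<le> card Ra" "4 \<le> card Rb" "4 \<le> card Rc" "4 \<le> card Rd" 
    and "card Qa \<le> 2" "card Qb \<le> 2" "card Qc \<le> 2" "card Qd \<le> 2" 
    and fin: "finite Qa" "finite Qb" "finite Qc" "finite Qd"
    and "Ra \<inter> Qa = {}" "Rb \<inter> Qb = {}" "Rc \<inter> Qc = {}" "Rd \<inter> Qd = {}"
  shows "\<exists>a\<in>Ra. \<exists>b\<in>Rb. \<exists>c\<in>Rc. \<exists>d\<in>Rd. quad_ok a b c d Qa Qb Qc Qd f g"
proof -
  consider (a) a where "a \<in> Ra" "a \<notin> Qb" "a \<notin> Qd" | (b) b where "b \<in> Rb" "b \<notin> Qc" "b \<notin> Qa"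
    | (c) c where "c \<in> Rc" "c \<notin> Qb" "c \<notin> Qd" | (d) d where "d \<in> Rd" "d \<notin> Qc" "d \<notin> Qa"
    | (n) "Ra \<subseteq> Qb \<union> Qd" "Rb \<subseteq> Qa \<union> Qc" "Rc \<subseteq> Qb \<union> Qd" "Rd \<subseteq> Qa \<union> Qc" by blast
  then show ?thesis
  proof cases
    case a then show ?thesis using quad_lists_4444_free[of Rb Rc Rd Qc a Ra] assms by blast
  next
    case b
    then have "\<exists>b\<in>Rb. \<exists>c\<in>Rc. \<exists>d\<in>Rd. \<exists>a\<in>Ra. quad_ok b c d a Qb Qc Qd Qa g f"
      using quad_lists_4444_free[of Rc Rd Ra Qd b Rb] assms by blast
    then show ?thesis using quad_ok_rotate by metis
  next
    case c
    then have "\<exists>c\<in>Rc. \<exists>d\<in>Rd. \<exists>a\<in>Ra. \<exists>b\<in>Rb. quad_ok c d a b Qc Qd Qa Qb f g"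
      using quad_lists_4444_free[of Rd Ra Rb Qa c Rc] assms by blast
    then show ?thesis using quad_ok_rotate by metis
  next
    case d
    then have "\<exists>d\<in>Rd. \<exists>a\<in>Ra. \<exists>b\<in>Rb. \<exists>c\<in>Rc. quad_ok d a b c Qd Qa Qb Qc g f"
      using quad_lists_4444_free[of Ra Rb Rc Qb d Rd] assms by blast
    then show ?thesis using quad_ok_rotate by metis
  next
    case n
    have bd: "card (Qb \<union> Qd) \<le> 4" "card (Qa \<union> Qc) \<le> 4"
      using card_Un_le[of Qb Qd] card_Un_le[of Qa Qc] assms by linarith+
    \<comment> \<open>The sizes force equality in all four inclusions. The lists of adjacent
      vertices become disjoint, and opposite vertices are told apart by taking, for instance,
      \<open>a\<close> outside \<open>Qd\<close> and \<open>c\<close> outside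
      \<open>Qb\<close>.\<close>
    have e: "Ra = Qb \<union> Qd" "Rc = Qb \<union> Qd" "Rb = Qa \<union> Qc" "Rd = Qa \<union> Qc"
      by (rule card_seteq; use n bd assms in auto)+
    obtain a where a: "a \<in> Ra" "a \<notin> Qd" using ex_notin_of_card_less[of Qd Ra] assms by auto
    obtain b where b: "b \<in> Rb" "b \<notin> Qc" using ex_notin_of_card_less[of Qc Rb] assms by auto
    obtain c where c: "c \<in> Rc" "c \<notin> Qb" using ex_notin_of_card_less[of Qb Rc] assms by auto
    obtain d where d: "d \<in> Rd" "d \<notin> Qa" using ex_notin_of_card_less[of Qa Rd] assms by auto
    have "Ra \<inter> Rb = {}" using e assms(13-16) by blast
    then have "a \<noteq> b" "b \<noteq> c" "c \<noteq> d" "d \<noteq> a" using a b c d e by auto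
    moreover have "a \<noteq> c" "b \<noteq> d" using a b c d e by auto
    moreover have "{b, d} \<noteq> Qa" "{b, d} \<noteq> Qc" "{a, c} \<noteq> Qb" "{a, c} \<noteq> Qd" using a b c d by auto
    ultimately show ?thesis using a b c d unfolding quad_ok_def by blast
  qed
qed

text \<open>\<open>Q\<close> holds the colours of the outer neighbours and \<open>R\<close> those
  left for the vertex. With degree \<open>d\<close> there are \<open>d - 2\<close> outer neighbours,
  each ruling out at most one further colour, and \<open>(d + 3) - (d - 2) = 5\<close>; a colour
  repeated outside shrinks \<open>Q\<close> and enlarges \<open>R\<close>. If the flag is set, one
  outer neighbour rules out no further colour, hence 6.\<close>

definition quad_list_size :: "'c set \<Rightarrow> 'c set \<Rightarrow> bool \<Rightarrow> bool" where
  "quad_list_size R Q f \<longleftrightarrow> R \<inter> Q = {} \<and> finite Q \<and> card Q \<le> 2 \<and> (if f then 6 else 5) \<le> card R + card Q"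

lemma quad_lists:
  assumes "quad_list_size Ra Qa f" "quad_list_size Rb Qb g" "quad_list_size Rc Qc f" "quad_list_size Rd Qd g"
  shows "\<exists>a\<in>Ra. \<exists>b\<in>Rb. \<exists>c\<in>Rc. \<exists>d\<in>Rd. quad_ok a b c d Qa Qb Qc Qd f g"
proof -
  note size = assms[unfolded quad_list_size_def]
  have ge3: "3 \<le> card Ra" "3 \<le> card Rb" "3 \<le> card Rc" "3 \<le> card Rd" using size by (auto split: if_splits)
  have ge4: "card Qa \<le> 1 \<Longrightarrow> 4 \<le> card Ra" "card Qb \<le> 1 \<Longrightarrow> 4 \<le> card Rb"
     "card Qc \<le> 1 \<Longrightarrow> 4 \<le> card Rc" "card Qd \<le> 1 \<Longrightarrow> 4 \<le> card Rd" using size by (auto split: if_splits)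
  \<comment> \<open>\<open>F\<close> and \<open>G\<close> say that the two opposite colours have to
    differ. Disjoint lists ensure this on one diagonal, and a common colour is used where it is
    permitted. If both demands stand, the nine combinations of their reasons reduce by rotation to
    three distributions of list sizes.\<close>
  define F where "F \<longleftrightarrow> f \<or> card Qb \<le> 1 \<or> card Qd \<le> 1"
  define G where "G \<longleftrightarrow> g \<or> card Qa \<le> 1 \<or> card Qc \<le> 1"
  consider (bd) "Rb \<inter> Rd = {}" | (ac) "Ra \<inter> Rc = {}" | (x) x where "x \<in> Ra" "x \<in> Rc" "\<not> F"
    | (y) y where "y \<in> Rb" "y \<in> Rd" "\<not> G" | (FG) F G by blast
  then show ?thesis
  proof cases
    case bd
    then show ?thesis using quad_lists_disjoint ge3 size by metis
  next
    case ac
    then have "\<exists>b\<in>Rb. \<exists>c\<in>Rc. \<exists>d\<in>Rd. \<exists>a\<in>Ra. quad_ok b c d a Qb Qc Qd Qa g f"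
      using quad_lists_disjoint[of Rb Rc Rd Ra Qc Qb Qd Qa g f] ge3 size by (simp add: Int_commute)
    then show ?thesis using quad_ok_rotate by metis
  next
    case x
    then have "\<not> f" "card Qb = 2" "card Qd = 2" using size by (auto simp: F_def)
    then show ?thesis using quad_lists_common[of Qa Ra Qc Rc g Rb Rd Qb Qd x] x size by (auto split: if_splits)
  next
    case y
    then have "\<not> g" "card Qa = 2" "card Qc = 2" using size by (auto simp: G_def)
    then have "\<exists>b\<in>Rb. \<exists>c\<in>Rc. \<exists>d\<in>Rd. \<exists>a\<in>Ra. quad_ok b c d a Qb Qc Qd Qa g f"
      using quad_lists_common[of Qb Rb Qd Rd f Rc Ra Qc Qa y] y size by (auto split: if_splits)
    then show ?thesis using quad_ok_rotate by metis
  next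
    case FG
    consider (fg) f g | (fa) f "card Qa \<le> 1" | (fc) f "card Qc \<le> 1" | (gb) g "card Qb \<le> 1" | (gd) g "card Qd \<le> 1"
      | (ab) "card Qa \<le> 1" "card Qb \<le> 1" | (bc) "card Qb \<le> 1" "card Qc \<le> 1"
      | (cd) "card Qc \<le> 1" "card Qd \<le> 1" | (da) "card Qd \<le> 1" "card Qa \<le> 1"
      using FG unfolding F_def G_def by blast
    then show ?thesis
    proof cases
      case fg then show ?thesis using quad_lists_4444[of Ra Rb Rc Rd Qa Qb Qc Qd f g] size by auto
    next
      case fa then show ?thesis using quad_lists_5343[of Ra Rb Rc Rd Qa Qc Qb Qd f g] size ge3 by auto
    next
      case fc then have "\<exists>c\<in>Rc. \<exists>d\<in>Rd. \<exists>a\<in>Ra. \<exists>b\<in>Rb. quad_ok c d a b Qc Qd Qa Qb f g"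
        using quad_lists_5343[of Rc Rd Ra Rb Qc Qa Qd Qb f g] size ge3 by auto
      then show ?thesis using quad_ok_rotate by metis
    next
      case gb then have "\<exists>b\<in>Rb. \<exists>c\<in>Rc. \<exists>d\<in>Rd. \<exists>a\<in>Ra. quad_ok b c d a Qb Qc Qd Qa g f"
        using quad_lists_5343[of Rb Rc Rd Ra Qb Qd Qc Qa g f] size ge3 by auto
      then show ?thesis using quad_ok_rotate by metis
    next
      case gd then have "\<exists>d\<in>Rd. \<exists>a\<in>Ra. \<exists>b\<in>Rb. \<exists>c\<in>Rc. quad_ok d a b c Qd Qa Qb Qc g f"
        using quad_lists_5343[of Rd Ra Rb Rc Qd Qb Qa Qc g f] size ge3 by auto
      then show ?thesis using quad_ok_rotate by metis
    next
      case ab then show ?thesis using quad_lists_4433[of Ra Rb Rc Rd Qa Qb Qd Qc f g] size ge3 ge4 by auto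
    next
      case bc then have "\<exists>b\<in>Rb. \<exists>c\<in>Rc. \<exists>d\<in>Rd. \<exists>a\<in>Ra. quad_ok b c d a Qb Qc Qd Qa g f"
        using quad_lists_4433[of Rb Rc Rd Ra Qb Qc Qa Qd g f] size ge3 ge4 by auto
      then show ?thesis using quad_ok_rotate by metis
    next
      case cd then have "\<exists>c\<in>Rc. \<exists>d\<in>Rd. \<exists>a\<in>Ra. \<exists>b\<in>Rb. quad_ok c d a b Qc Qd Qa Qb f g"
        using quad_lists_4433[of Rc Rd Ra Rb Qc Qd Qb Qa f g] size ge3 ge4 by auto
      then show ?thesis using quad_ok_rotate by metis
    next
      case da then have "\<exists>d\<in>Rd. \<exists>a\<in>Ra. \<exists>b\<in>Rb. \<exists>c\<in>Rc. quad_ok d a b c Qd Qa Qb Qc g f"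
        using quad_lists_4433[of Rd Ra Rb Rc Qd Qa Qc Qb g f] size ge3 ge4 by auto
      then show ?thesis using quad_ok_rotate by metis
    qed
  qed
qed

section \<open>Conflict-free neighbourhoods\<close>

definition conflict_free :: "('a \<Rightarrow> 'c) \<Rightarrow> 'a set \<Rightarrow> bool" where
  "conflict_free \<phi> A \<longleftrightarrow> A = {} \<or> (\<exists>w\<in>A. \<forall>w'\<in>A. \<phi> w' = \<phi> w \<longrightarrow> w' = w)"

text \<open>\<open>forbidden \<phi> A\<close> consists of the colours that leave no unique colour when a vertex outside \<open>A\<close> receives them.\<close>

definition forbidden :: "('a \<Rightarrow> 'c) \<Rightarrow> 'a set \<Rightarrow> 'c set" where
  "forbidden \<phi> A = {c \<in> \<phi> ` A. \<forall>w\<in>A. \<phi> w = c \<or> (\<exists>w'\<in>A. w' \<noteq> w \<and> \<phi> w' = \<phi> w)}"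

lemma conflict_free_cong: "(\<And>w. w \<in> A \<Longrightarrow> \<phi> w = \<psi> w) \<Longrightarrow> conflict_free \<phi> A = conflict_free \<psi> A"
  unfolding conflict_free_def by (intro disj_cong refl bex_cong) auto

lemma forbidden_cong: "(\<And>w. w \<in> A \<Longrightarrow> \<phi> w = \<psi> w) \<Longrightarrow> forbidden \<phi> A = forbidden \<psi> A"
  unfolding forbidden_def by (auto simp: image_iff)

lemma conflict_free_insert:
  assumes "\<And>w. w \<in> A \<Longrightarrow> \<psi> w = \<phi> w" "s \<notin> A" "\<psi> s \<notin> forbidden \<phi> A"
  shows "conflict_free \<psi> (insert s A)"
proof (cases "\<psi> s \<in> \<phi> ` A")
  case True
  then obtain w where "w \<in> A" "\<phi> w \<noteq> \<psi> s" "\<forall>w'\<in>A. \<phi> w' = \<phi> w \<longrightarrow> w' = w"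
    using assms(3) unfolding forbidden_def by blast
  then have "\<forall>w'\<in>insert s A. \<psi> w' = \<psi> w \<longrightarrow> w' = w" using assms by auto
  then show ?thesis using \<open>w \<in> A\<close> unfolding conflict_free_def by blast
next
  case False
  then have "\<forall>w'\<in>insert s A. \<psi> w' = \<psi> s \<longrightarrow> w' = s" using assms by (metis image_eqI insert_iff)
  then show ?thesis unfolding conflict_free_def by blast
qed

lemma finite_forbidden: "finite A \<Longrightarrow> finite (forbidden \<phi> A)"
  unfolding forbidden_def by simp

lemma forbidden_repeated:
  assumes "c \<in> forbidden \<phi> A" "w \<in> A" "\<phi> w \<noteq> c"
  shows "\<exists>w'\<in>A. w' \<noteq> w \<and> \<phi> w' = \<phi> w"
  using assms unfolding forbidden_def by blast

text \<open>Of two forbidden colours each must be repeated, because it may not stay unique when the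
  other is added; this takes four vertices. The degree bound 4 enters here: a neighbourhood without
  its last vertex has at most three.\<close>

lemma card_forbidden_le:
  assumes "finite A" "card A \<le> 3"
  shows "card (forbidden \<phi> A) \<le> 1"
proof (rule ccontr)
  assume "\<not> ?thesis"
  then obtain c d where cd: "c \<in> forbidden \<phi> A" "d \<in> forbidden \<phi> A" "c \<noteq> d"
    using card_2_cases[of "forbidden \<phi> A"] by auto
  then obtain x y where x: "x \<in> A" "\<phi> x = c" and y: "y \<in> A" "\<phi> y = d"
    unfolding forbidden_def by blast
  obtain x' where x': "x' \<in> A" "x' \<noteq> x" "\<phi> x' = c" using forbidden_repeated[OF cd(2) x(1)] x cd by auto
  obtain y' where y': "y' \<in> A" "y' \<noteq> y" "\<phi> y' = d" using forbidden_repeated[OF cd(1) y(1)] y cd by auto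
  have "card {x, x', y, y'} = 4" using x y x' y' cd(3) by (auto simp: card_insert_if)
  moreover have "card {x, x', y, y'} \<le> card A" using x y x' y' assms by (intro card_mono) auto
  ultimately show False using assms by simp
qed

text \<open>If three colours occurred and one were forbidden, each of the other two would have to be
  repeated; already one repetition makes four vertices.\<close>

lemma card_image_le_2_if_forbidden:
  assumes "finite A" "card A \<le> 3" "forbidden \<phi> A \<noteq> {}"
  shows "card (\<phi> ` A) \<le> 2"
proof (rule ccontr)
  assume n: "\<not> ?thesis"
  obtain c where c: "c \<in> forbidden \<phi> A" using assms by blast
  then obtain x where x: "x \<in> A" "\<phi> x = c" unfolding forbidden_def by blast
  obtain y where y: "y \<in> A" "\<phi> y \<noteq> c" using ex_avoid1[of "\<phi> ` A" c] n by auto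
  obtain z where z: "z \<in> A" "\<phi> z \<noteq> c" "\<phi> z \<noteq> \<phi> y" using ex_avoid2[of "\<phi> ` A" c "\<phi> y"] n by auto
  obtain y' where y': "y' \<in> A" "y' \<noteq> y" "\<phi> y' = \<phi> y" using forbidden_repeated[OF c y] by auto
  have "card {x, y, y', z} = 4" using x y z y' by (auto simp: card_insert_if)
  moreover have "card {x, y, y', z} \<le> card A" using x y z y' assms by (intro card_mono) auto
  ultimately show False using assms by simp
qed

lemma conflict_free_unique:
  "w \<in> A \<Longrightarrow> (\<And>w'. w' \<in> A \<Longrightarrow> \<phi> w' = \<phi> w \<Longrightarrow> w' = w) \<Longrightarrow> conflict_free \<phi> A"
  unfolding conflict_free_def by blast

text \<open>If \<open>A\<close> shows at most one colour, one of the distinct colours of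
  \<open>b\<close> and \<open>d\<close> is new. If it shows two, its vertices have different
  colours, and \<open>{\<phi> b, \<phi> d}\<close>, not being the same set, misses one of them,
  which is then unique even if \<open>b\<close> and \<open>d\<close> agree.\<close>

lemma conflict_free_Un_pair:
  assumes "finite A" "card A \<le> 2" "b \<notin> A" "d \<notin> A"
    and "\<phi> b \<noteq> \<phi> d \<or> (b \<noteq> d \<and> card (\<phi> ` A) = 2)" "{\<phi> b, \<phi> d} \<noteq> \<phi> ` A"
  shows "conflict_free \<phi> (A \<union> {b, d})"
proof (cases "card (\<phi> ` A) \<le> 1")
  case True
  have bd: "\<phi> b \<noteq> \<phi> d" using True assms(5) by auto
  have "\<phi> b \<notin> \<phi> ` A \<or> \<phi> d \<notin> \<phi> ` A"
    using True bd assms(1) card_le_Suc0_iff_eq[of "\<phi> ` A"] by (metis One_nat_def finite_imageI)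
  then show ?thesis
  proof
    assume h: "\<phi> b \<notin> \<phi> ` A"
    show ?thesis by (rule conflict_free_unique[of b]) (use h bd in \<open>auto simp: image_iff\<close>)
  next
    assume h: "\<phi> d \<notin> \<phi> ` A"
    show ?thesis by (rule conflict_free_unique[of d]) (use h bd in \<open>auto simp: image_iff\<close>)
  qed
next
  case False
  then have c2: "card (\<phi> ` A) = 2" "card A = 2" using card_image_le[OF assms(1), of \<phi>] assms(2) by auto
  then have inj: "inj_on \<phi> A" using assms(1) by (simp add: eq_card_imp_inj_on)
  have "\<not> \<phi> ` A \<subseteq> {\<phi> b, \<phi> d}"
  proof
    assume h: "\<phi> ` A \<subseteq> {\<phi> b, \<phi> d}"
    have "card {\<phi> b, \<phi> d} \<le> card (\<phi> ` A)" using c2 card_insert_le_m1[of 2 "{\<phi> d}" "\<phi> b"] by simp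
    then show False using card_seteq[OF _ h] assms(6) by auto
  qed
  then obtain w where w: "w \<in> A" "\<phi> w \<noteq> \<phi> b" "\<phi> w \<noteq> \<phi> d" by blast
  show ?thesis by (rule conflict_free_unique[of w]) (use w inj in \<open>auto dest: inj_onD\<close>)
qed

text \<open>\<open>A\<close> and \<open>B\<close> are the neighbours of a vertex that are already coloured and still to be coloured;
  \<open>G\<close> holds at most one colour, and it is empty only if distinct colours on \<open>B\<close> suffice.\<close>

lemma ex_avoid_colour:
  fixes \<psi> :: "'a \<Rightarrow> 'c"
  assumes "finite A" "finite B" "card A + card B \<le> 4" "B \<noteq> {}" "A \<inter> B = {}"
  shows "\<exists>G. finite G \<and> card G \<le> 1 \<and>
    (\<forall>\<phi>. (\<forall>w\<in>A. \<phi> w = \<psi> w) \<longrightarrow> \<phi> ` B \<inter> G = {} \<longrightarrow> (G = {} \<longrightarrow> inj_on \<phi> B) \<longrightarrow> conflict_free \<phi> (A \<union> B))"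
proof (cases "card B = 1")
  case True
  then obtain b where b: "B = {b}" by (rule card_1_singletonE)
  have "conflict_free \<phi> (A \<union> B)" if "\<forall>w\<in>A. \<phi> w = \<psi> w" "\<phi> ` B \<inter> forbidden \<psi> A = {}" for \<phi>
    using conflict_free_insert[of A \<phi> \<psi> b] that b assms by auto
  moreover have "card (forbidden \<psi> A) \<le> 1" using card_forbidden_le[of A \<psi>] assms True by auto
  ultimately show ?thesis using finite_forbidden[OF assms(1), of \<psi>] by blast
next
  case False
  then have B2: "2 \<le> card B" using assms(2,4) by (metis One_nat_def Suc_1 card_0_eq le_antisym not_less_eq_eq zero_le)
  show ?thesis
  proof (cases "\<exists>w\<in>A. \<forall>w'\<in>A. \<psi> w' = \<psi> w \<longrightarrow> w' = w")
    case True
    then obtain w where w: "w \<in> A" "\<And>w'. w' \<in> A \<Longrightarrow> \<psi> w' = \<psi> w \<Longrightarrow> w' = w" by blast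
    have "conflict_free \<phi> (A \<union> B)" if "\<forall>w\<in>A. \<phi> w = \<psi> w" "\<phi> ` B \<inter> {\<psi> w} = {}" for \<phi>
      by (rule conflict_free_unique[of w]) (use w that in \<open>auto simp: image_iff\<close>)
    then show ?thesis by (intro exI[of _ "{\<psi> w}"]) auto
  next
    case False
    have "conflict_free \<phi> (A \<union> B)" if e: "\<forall>w\<in>A. \<phi> w = \<psi> w" and inj: "inj_on \<phi> B" for \<phi>
    proof (cases "A = {}")
      case True
      obtain b where "b \<in> B" using assms(4) by blast
      then show ?thesis using True inj by (intro conflict_free_unique[of b]) (auto dest: inj_onD)
    next
      case A: False
      then obtain x where x: "x \<in> A" by blast
      then obtain y where y: "y \<in> A" "\<psi> y = \<psi> x" "y \<noteq> x" using False by blast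
      have "{x, y} \<subseteq> A" using x y by auto
      moreover have "card {x, y} = 2" using y by auto
      \<comment> \<open>As \<open>B\<close> has at least two vertices, \<open>A\<close> consists of
        exactly two, of equal colour. Of two distinct colours on \<open>B\<close> one differs from
        it.\<close>
      ultimately have A2: "A = {x, y}" using card_seteq[of A "{x, y}"] assms(1,3) B2 by simp
      obtain b where b: "b \<in> B" "\<phi> b \<noteq> \<psi> x"
        using card_2_cases[OF B2] inj by (metis inj_onD)
      show ?thesis
        by (rule conflict_free_unique[of b]) (use b inj A2 e y assms(5) in \<open>auto dest: inj_onD\<close>)
    qed
    then show ?thesis by (intro exI[of _ "{}"]) auto
  qed
qed

lemma card_UN_le_card:
  assumes "finite A" "\<And>u. u \<in> A \<Longrightarrow> card (G u) \<le> 1"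
  shows "card (\<Union>u\<in>A. G u) \<le> card {u \<in> A. G u \<noteq> {}}"
proof -
  have "(\<Union>u\<in>A. G u) = (\<Union>u\<in>{u \<in> A. G u \<noteq> {}}. G u)" by auto
  also have "card \<dots> \<le> (\<Sum>u\<in>{u \<in> A. G u \<noteq> {}}. card (G u))" using assms by (intro card_UN_le) auto
  also have "\<dots> \<le> (\<Sum>u\<in>{u \<in> A. G u \<noteq> {}}. 1)" using assms by (intro sum_mono) auto
  finally show ?thesis by simp
qed

lemma card_UN_le_card': 
  assumes "finite A" "\<And>u. u \<in> A \<Longrightarrow> card (G u) \<le> 1"
  shows "card (\<Union>u\<in>A. G u) \<le> card A"
  using card_UN_le_card[OF assms] card_mono[of A "{u \<in> A. G u \<noteq> {}}"] assms(1) by force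

section \<open>Greedy partial colourings\<close>

locale list_graph =
  fixes V :: "'a set" and N :: "'a \<Rightarrow> 'a set" and L :: "'a \<Rightarrow> 'c set"
  assumes finite_V: "finite V"
    and N_sym: "y \<in> N x \<Longrightarrow> x \<in> N y"
    and N_irrefl: "x \<notin> N x"
    and N_subset: "N x \<subseteq> V"
    and card_N: "card (N x) \<le> 4"
    and card_L: "x \<in> V \<Longrightarrow> card (N x) + 3 \<le> card (L x)"
begin

lemma finite_N: "finite (N x)"
  using N_subset finite_V by (rule finite_subset)

lemma card_N_Diff: "y \<in> N x \<Longrightarrow> card (N x - {y}) = card (N x) - 1"
  by simp

lemma card_N_Diff_le: "y \<in> N x \<Longrightarrow> card (N x - {y}) \<le> 3"
  using card_N[of x] by simp

lemma card_N_pos: "y \<in> N x \<Longrightarrow> 0 < card (N x)"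
  using finite_N card_gt_0_iff by blast

text \<open>The neighbourhood condition concerns every vertex with all neighbours in
  \<open>W\<close>, coloured or not, since a neighbourhood may be completed before its centre is
  coloured. On a closed set it covers all neighbourhoods of its vertices.\<close>

definition partial_colouring :: "'a set \<Rightarrow> ('a \<Rightarrow> 'c) \<Rightarrow> bool" where
  "partial_colouring W \<phi> \<longleftrightarrow> (\<forall>x\<in>W. \<phi> x \<in> L x \<and> (\<forall>y\<in>N x \<inter> W. \<phi> y \<noteq> \<phi> x)) \<and>
     (\<forall>u\<in>V. N u \<subseteq> W \<longrightarrow> conflict_free \<phi> (N u))"

definition closed_set :: "'a set \<Rightarrow> bool" where
  "closed_set K \<longleftrightarrow> K \<subseteq> V \<and> (\<forall>x\<in>K. N x \<subseteq> K)"

text \<open>The connected components, as minimal nonempty closed sets: minimality says that an edge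
  leaves every nonempty proper subset, which is the form in which the greedy colouring uses
  connectedness.\<close>

definition component :: "'a set \<Rightarrow> bool" where
  "component T \<longleftrightarrow> closed_set T \<and> T \<noteq> {} \<and> (\<forall>U. closed_set U \<and> U \<noteq> {} \<and> U \<subseteq> T \<longrightarrow> U = T)"

lemma greedy_step:
  assumes "partial_colouring W \<phi>" "x \<in> V" "x \<notin> W" "s \<in> N x" "s \<notin> W" "\<not> N s \<subseteq> insert x W"
  shows "\<exists>\<phi>'. partial_colouring (insert x W) \<phi>'"
proof -
  define A where "A = N x - {s}"
  have fA: "finite A" "card A = card (N x) - 1" using finite_N assms(4) by (auto simp: A_def)
  define F where "F = (\<Union>u\<in>A. forbidden \<phi> (N u - {x}))"
  have F1: "card (forbidden \<phi> (N u - {x})) \<le> 1" if "u \<in> A" for u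
    using that N_sym card_N_Diff_le finite_N by (intro card_forbidden_le) (auto simp: A_def)
  have cF: "card F \<le> card A" unfolding F_def using F1 fA by (intro card_UN_le_card')
  have fF: "finite F" unfolding F_def using fA finite_N by (auto intro: finite_forbidden)
  have "card (\<phi> ` A \<union> F) \<le> card (\<phi> ` A) + card F" by (rule card_Un_le)
  also have "\<dots> \<le> 2 * (card (N x) - 1)" using cF fA card_image_le[OF fA(1), of \<phi>] by simp
  also have "\<dots> < card (L x)" using card_L[OF assms(2)] card_N[of x] card_N_pos[OF assms(4)] by simp
  finally obtain c where c: "c \<in> L x" "c \<notin> \<phi> ` A" "c \<notin> F"
    using ex_notin_of_card_less[of "\<phi> ` A \<union> F" "L x"] fF fA by auto
  let ?\<phi> = "\<phi>(x := c)"
  have "conflict_free ?\<phi> (N u)" if u: "u \<in> V" "N u \<subseteq> insert x W" for u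
  proof (cases "x \<in> N u")
    case True
    \<comment> \<open>The neighbour \<open>s\<close> has another uncoloured neighbour, so colouring
      \<open>x\<close> does not complete its neighbourhood, and only the \<open>d - 1\<close> other
      neighbours can rule out a colour.\<close>
    then have "u \<in> A" using N_sym u assms(6) by (auto simp: A_def)
    then have "conflict_free ?\<phi> (insert x (N u - {x}))"
      using c by (intro conflict_free_insert[of _ _ \<phi>]) (auto simp: F_def)
    then show ?thesis using True by (simp add: insert_absorb)
  next
    case False
    then have "conflict_free \<phi> (N u)" using assms(1) u unfolding partial_colouring_def by blast
    then show ?thesis using False conflict_free_cong[of "N u" \<phi> ?\<phi>] by force
  qed
  moreover have "?\<phi> z \<in> L z \<and> (\<forall>y\<in>N z \<inter> insert x W. ?\<phi> y \<noteq> ?\<phi> z)" if z: "z \<in> insert x W" for z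
  proof (cases "z = x")
    case True
    then show ?thesis using c assms N_irrefl by (auto simp: A_def)
  next
    case False
    then have "z \<in> W" using z by simp
    have "\<phi> z \<noteq> c" if "x \<in> N z" using that N_sym c \<open>z \<in> W\<close> assms(5) by (auto simp: A_def)
    then show ?thesis using False assms(1) \<open>z \<in> W\<close> unfolding partial_colouring_def by auto
  qed
  ultimately have "partial_colouring (insert x W) ?\<phi>" unfolding partial_colouring_def by blast
  then show ?thesis by blast
qed

text \<open>The induction runs against the order of colouring: the uncoloured set \<open>U\<close>
  grows from \<open>S\<close> by an adjacent vertex \<open>x\<close>, and \<open>x\<close> is
  coloured after everything outside the enlarged set. A neighbour within \<open>U\<close> keeps the
  neighbourhood of \<open>s\<close> incomplete.\<close>

lemma greedy_colouring:
  assumes "component T" "S \<subseteq> T" "S \<noteq> {}" "\<And>s. s \<in> S \<Longrightarrow> N s \<inter> S \<noteq> {}"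
  shows "\<exists>\<phi>. partial_colouring (T - S) \<phi>"
proof -
  have T_closed: "closed_set T" using assms(1) unfolding component_def by blast
  then have TV: "T \<subseteq> V" unfolding closed_set_def by blast
  have "\<exists>\<phi>. partial_colouring (T - U) \<phi>"
    if "card (T - U) = n" "U \<subseteq> T" "U \<noteq> {}" "\<And>s. s \<in> U \<Longrightarrow> N s \<inter> U \<noteq> {}" for n U
    using that
  proof (induction n arbitrary: U)
    case 0
    then have "T - U = {}" using finite_subset[OF TV finite_V] by simp
    then show ?case by (auto simp: partial_colouring_def conflict_free_def)
  next
    case (Suc n)
    have "U \<noteq> T" using Suc.prems(1) by auto
    then have "\<not> closed_set U" using assms(1) Suc.prems unfolding component_def by blast
    then obtain s x where sx: "s \<in> U" "x \<in> N s" "x \<notin> U" using Suc.prems TV unfolding closed_set_def by blast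
    have "N s \<subseteq> T" using T_closed sx(1) Suc.prems(2) unfolding closed_set_def by blast
    then have xT: "x \<in> T" using sx(2) by blast
    have xs: "s \<in> N x" using sx(2) by (rule N_sym)
    have "T - insert x U = T - U - {x}" by blast
    then have "card (T - insert x U) = n" using Suc.prems(1) xT sx by simp
    moreover have "N t \<inter> insert x U \<noteq> {}" if "t \<in> insert x U" for t
      using that Suc.prems(4) xs sx by blast
    ultimately obtain \<phi> where \<phi>: "partial_colouring (T - insert x U) \<phi>"
      using Suc.IH[of "insert x U"] Suc.prems xT by blast
    have "N s \<inter> U \<noteq> {}" using Suc.prems(4) sx by blast
    then have "\<exists>\<phi>. partial_colouring (insert x (T - insert x U)) \<phi>"
      using \<phi> xT TV xs sx by (intro greedy_step[of _ _ x s]) auto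
    moreover have "insert x (T - insert x U) = T - U" using xT sx by blast
    ultimately show ?case by simp
  qed
  then show ?thesis using assms(2-4) by blast
qed

lemma partial_colouring_extend:
  assumes "partial_colouring (T - S) \<psi>" "\<And>x. x \<notin> S \<Longrightarrow> \<phi> x = \<psi> x" "closed_set T"
    and "\<And>s. s \<in> S \<Longrightarrow> \<phi> s \<in> L s" "\<And>s y. s \<in> S \<Longrightarrow> y \<in> N s \<Longrightarrow> \<phi> y \<noteq> \<phi> s"
    and "\<And>u. u \<in> T \<Longrightarrow> N u \<inter> S \<noteq> {} \<Longrightarrow> conflict_free \<phi> (N u)" 
  shows "partial_colouring T \<phi>"
  unfolding partial_colouring_def
proof (intro conjI ballI impI)
  fix x assume x: "x \<in> T"
  show "\<phi> x \<in> L x"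
    using assms(1,2,4) x unfolding partial_colouring_def by (cases "x \<in> S") auto
  fix y assume y: "y \<in> N x \<inter> T"
  show "\<phi> y \<noteq> \<phi> x"
  proof (cases "x \<in> S \<or> y \<in> S")
    case True
    then show ?thesis using assms(5) y N_sym by (metis IntD1)
  next
    case False
    then show ?thesis using assms(1,2) x y unfolding partial_colouring_def by auto
  qed
next
  fix u assume u: "u \<in> V" "N u \<subseteq> T"
  show "conflict_free \<phi> (N u)"
  proof (cases "N u \<inter> S = {}")
    case True
    then have "conflict_free \<psi> (N u)" using u assms(1) unfolding partial_colouring_def by blast
    then show ?thesis using conflict_free_cong[of "N u" \<phi> \<psi>] assms(2) True by blast
  next
    case False
    then obtain s where "s \<in> N u" by blast
    then have "u \<in> T" using u N_sym assms(3) unfolding closed_set_def by blast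
    then show ?thesis using assms(6) False by blast
  qed
qed

section \<open>Lists that remain on a small set\<close>

definition avoidance :: "'a set \<Rightarrow> ('a \<Rightarrow> 'c) \<Rightarrow> ('a \<Rightarrow> 'c set) \<Rightarrow> bool" where
  "avoidance S \<psi> G \<longleftrightarrow> (\<forall>u. N u \<inter> S \<noteq> {} \<longrightarrow> finite (G u) \<and> card (G u) \<le> 1 \<and>
     (\<forall>\<phi>. (\<forall>w\<in>N u - S. \<phi> w = \<psi> w) \<longrightarrow> \<phi> ` (N u \<inter> S) \<inter> G u = {} \<longrightarrow>
        (G u = {} \<longrightarrow> inj_on \<phi> (N u \<inter> S)) \<longrightarrow> conflict_free \<phi> (N u)))"

lemma ex_avoidance: "\<exists>G. avoidance S \<psi> G"
proof -
  have "\<exists>G. N u \<inter> S \<noteq> {} \<longrightarrow> finite G \<and> card G \<le> 1 \<and>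
     (\<forall>\<phi>. (\<forall>w\<in>N u - S. \<phi> w = \<psi> w) \<longrightarrow> \<phi> ` (N u \<inter> S) \<inter> G = {} \<longrightarrow>
        (G = {} \<longrightarrow> inj_on \<phi> (N u \<inter> S)) \<longrightarrow> conflict_free \<phi> (N u))" for u
  proof (cases "N u \<inter> S = {}")
    case False
    have "card (N u - S) + card (N u \<inter> S) \<le> 4" using card_N[of u] finite_N[of u]
      by (metis card_Diff_subset_Int card_Int_Diff add.commute finite_Int)
    then have "\<exists>G. finite G \<and> card G \<le> 1 \<and>
      (\<forall>\<phi>. (\<forall>w\<in>N u - S. \<phi> w = \<psi> w) \<longrightarrow> \<phi> ` (N u \<inter> S) \<inter> G = {} \<longrightarrow>
        (G = {} \<longrightarrow> inj_on \<phi> (N u \<inter> S)) \<longrightarrow> conflict_free \<phi> (N u - S \<union> (N u \<inter> S)))"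
      using False finite_N[of u] by (intro ex_avoid_colour) auto
    moreover have "N u - S \<union> (N u \<inter> S) = N u" by blast
    ultimately show ?thesis by simp
  qed auto
  then have "\<forall>u. \<exists>G. N u \<inter> S \<noteq> {} \<longrightarrow> finite G \<and> card G \<le> 1 \<and>
     (\<forall>\<phi>. (\<forall>w\<in>N u - S. \<phi> w = \<psi> w) \<longrightarrow> \<phi> ` (N u \<inter> S) \<inter> G = {} \<longrightarrow>
        (G = {} \<longrightarrow> inj_on \<phi> (N u \<inter> S)) \<longrightarrow> conflict_free \<phi> (N u))" ..
  then show ?thesis unfolding avoidance_def by (rule choice)
qed

text \<open>A choice from these lists is compatible with everything outside \<open>S\<close>, except
  that a vertex with empty \<open>G u\<close> rules out no colour and demands instead that its
  neighbours in \<open>S\<close> receive distinct colours.\<close>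

definition residual :: "'a set \<Rightarrow> ('a \<Rightarrow> 'c) \<Rightarrow> ('a \<Rightarrow> 'c set) \<Rightarrow> 'a \<Rightarrow> 'c set" where
  "residual S \<psi> G s = L s - \<psi> ` (N s - S) - (\<Union>u\<in>N s - S. G u)"

lemma card_residual:
  assumes "avoidance S \<psi> G" "s \<in> S" "s \<in> V"
  shows "card (N s) + 3 \<le> card (residual S \<psi> G s) + card (\<psi> ` (N s - S)) + card {u \<in> N s - S. G u \<noteq> {}}"
proof -
  have G: "finite (G u)" "card (G u) \<le> 1" if "u \<in> N s - S" for u
    using that assms N_sym unfolding avoidance_def by blast+
  have f: "finite (N s - S)" using finite_N by simp
  have "card (\<Union>u\<in>N s - S. G u) \<le> card {u \<in> N s - S. G u \<noteq> {}}" using G f by (intro card_UN_le_card)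
  moreover have "card (L s) - card (\<psi> ` (N s - S)) \<le> card (L s - \<psi> ` (N s - S))"
    using f by (intro diff_card_le_card_Diff) simp
  moreover have "card (L s - \<psi> ` (N s - S)) - card (\<Union>u\<in>N s - S. G u) \<le> card (residual S \<psi> G s)"
    unfolding residual_def using f G by (intro diff_card_le_card_Diff) auto
  ultimately show ?thesis using card_L[OF assms(3)] by linarith
qed

lemma residual_extend:
  assumes "partial_colouring (T - S) \<psi>" "closed_set T" "S \<subseteq> T" "avoidance S \<psi> G"
    and agree: "\<And>x. x \<notin> S \<Longrightarrow> \<phi> x = \<psi> x"
    and res: "\<And>s. s \<in> S \<Longrightarrow> \<phi> s \<in> residual S \<psi> G s"
    and proper: "\<And>s y. s \<in> S \<Longrightarrow> y \<in> N s \<inter> S \<Longrightarrow> \<phi> y \<noteq> \<phi> s"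
    and inj: "\<And>u. u \<in> T - S \<Longrightarrow> G u = {} \<Longrightarrow> inj_on \<phi> (N u \<inter> S)"
    and cf: "\<And>s. s \<in> S \<Longrightarrow> conflict_free \<phi> (N s)"
  shows "partial_colouring T \<phi>"
proof (rule partial_colouring_extend[OF assms(1) agree assms(2)])
  fix s assume s: "s \<in> S"
  show "\<phi> s \<in> L s" using res[OF s] by (simp add: residual_def)
  fix y assume y: "y \<in> N s"
  show "\<phi> y \<noteq> \<phi> s"
  proof (cases "y \<in> S")
    case True then show ?thesis using proper s y by blast
  next
    case False
    then have "\<psi> y \<in> \<psi> ` (N s - S)" using y by blast
    moreover have "\<phi> s \<notin> \<psi> ` (N s - S)" using res[OF s] by (simp add: residual_def)
    ultimately show ?thesis using agree[OF False] by metis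
  qed
next
  fix u assume u: "u \<in> T" "N u \<inter> S \<noteq> {}"
  show "conflict_free \<phi> (N u)"
  proof (cases "u \<in> S")
    case False
    have "\<phi> s \<notin> G u" if "s \<in> N u \<inter> S" for s
      using res[of s] that False N_sym unfolding residual_def by blast
    then have "\<phi> ` (N u \<inter> S) \<inter> G u = {}" by blast
    then show ?thesis using assms(4) u agree inj[of u] False unfolding avoidance_def by auto
  qed (rule cf)
qed

section \<open>Components with a triangle or a 4-cycle\<close>

lemma partial_colouring_triangle:
  assumes T: "component T" and abc: "a \<in> T" "b \<in> N a" "c \<in> N b" "a \<in> N c"
  shows "\<exists>\<phi>. partial_colouring T \<phi>"
proof -
  let ?S = "{a, b, c}"
  have Tc: "closed_set T" using T unfolding component_def by blast
  then have TV: "T \<subseteq> V" and TN: "\<And>x. x \<in> T \<Longrightarrow> N x \<subseteq> T" unfolding closed_set_def by blast+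
  have ST: "?S \<subseteq> T" using TN abc by blast
  have SV: "a \<in> V" "b \<in> V" "c \<in> V" using ST TV by auto
  have nb: "b \<in> N a" "c \<in> N a" "a \<in> N b" "c \<in> N b" "a \<in> N c" "b \<in> N c" using abc N_sym by blast+
  have dist: "a \<noteq> b" "b \<noteq> c" "c \<noteq> a" using nb N_irrefl by auto
  have "N s \<inter> ?S \<noteq> {}" if "s \<in> ?S" for s using that nb by blast
  then obtain \<psi> where \<psi>: "partial_colouring (T - ?S) \<psi>" using greedy_colouring[OF T ST] by blast
  obtain G where G: "avoidance ?S \<psi> G" using ex_avoidance by blast
  define R where "R = residual ?S \<psi> G"
  define Q where "Q s = \<psi> ` (N s - ?S)" for s
  have NS: "N a \<inter> ?S = {b, c}" "N b \<inter> ?S = {a, c}" "N c \<inter> ?S = {a, b}" using nb N_irrefl by auto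
  have "card (N s - ?S) + 2 = card (N s)" if "N s \<inter> ?S = {x, y}" "x \<noteq> y" for s x y
    using card_Int_Diff[OF finite_N[of s], of ?S] that(2) unfolding that(1) by simp
  from this[OF NS(1)] this[OF NS(2)] this[OF NS(3)]
  have card_out: "card (N s - ?S) + 2 = card (N s)" if "s \<in> ?S" for s using that dist by blast
  have size: "card (N s - ?S) \<le> 2" "card (Q s) \<le> 2" "3 \<le> card (R s)" "finite (Q s)" "R s \<inter> Q s = {}" if s: "s \<in> ?S" for s
  proof -
    have fin: "finite (N s - ?S)" using finite_N by simp
    show 1: "card (N s - ?S) \<le> 2" using card_out[OF s] card_N[of s] by linarith
    have Q: "card (Q s) \<le> card (N s - ?S)" unfolding Q_def using fin by (rule card_image_le)
    then show "card (Q s) \<le> 2" using 1 by linarith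
    have "card {u \<in> N s - ?S. G u \<noteq> {}} \<le> card (N s - ?S)" using fin by (intro card_mono) auto
    moreover have "card (N s) + 3 \<le> card (R s) + card (Q s) + card {u \<in> N s - ?S. G u \<noteq> {}}"
      unfolding R_def Q_def using SV s by (intro card_residual[OF G]) auto
    \<comment> \<open>With degree \<open>d\<close> at least
      \<open>(d + 3) - 2 * (d - 2) = 7 - d\<close> colours remain.\<close>
    ultimately show "3 \<le> card (R s)" using 1 Q card_out[OF s] by linarith
    show "finite (Q s)" unfolding Q_def using fin by simp
    show "R s \<inter> Q s = {}" unfolding R_def Q_def residual_def by blast
  qed
  obtain \<alpha> \<beta> \<gamma> where col: "\<alpha> \<in> R a" "\<beta> \<in> R b" "\<gamma> \<in> R c" "\<alpha> \<noteq> \<beta>" "\<beta> \<noteq> \<gamma>" "\<gamma> \<noteq> \<alpha>"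
    and ne: "{\<beta>, \<gamma>} \<noteq> Q a" "{\<alpha>, \<gamma>} \<noteq> Q b" "{\<alpha>, \<beta>} \<noteq> Q c"
    using triangle_lists[of "R a" "R b" "R c" "Q a" "Q b" "Q c"] size by auto
  define \<phi> where "\<phi> = \<psi>(a := \<alpha>, b := \<beta>, c := \<gamma>)"
  have \<phi>: "\<phi> a = \<alpha>" "\<phi> b = \<beta>" "\<phi> c = \<gamma>" "\<And>x. x \<notin> ?S \<Longrightarrow> \<phi> x = \<psi> x" using dist by (auto simp: \<phi>_def)
  have inj: "inj_on \<phi> ?S" using \<phi> col by (auto simp: inj_on_def)
  have im: "\<phi> ` (N s - ?S) = Q s" for s unfolding Q_def using \<phi>(4) by (intro image_cong) auto
  have pair: "conflict_free \<phi> (N s)" if "s \<in> ?S" "N s \<inter> ?S = {x, y}" "x \<noteq> y" "{\<phi> x, \<phi> y} \<noteq> Q s" for s x y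
  proof -
    have xy: "x \<in> ?S" "y \<in> ?S" using that by blast+
    have "\<phi> x \<noteq> \<phi> y" using inj_onD[OF inj _ xy] that(3) by blast
    then have "conflict_free \<phi> (N s - ?S \<union> {x, y})"
      using xy that size(1)[OF that(1)] finite_N im by (intro conflict_free_Un_pair) auto
    moreover have "N s - ?S \<union> {x, y} = N s" using that(2) by blast
    ultimately show ?thesis by simp
  qed
  have "partial_colouring T \<phi>"
  proof (rule residual_extend[OF \<psi> Tc ST G])
    show "\<phi> s \<in> residual ?S \<psi> G s" if "s \<in> ?S" for s using that \<phi> col unfolding R_def by auto
    show "\<phi> y \<noteq> \<phi> s" if "s \<in> ?S" "y \<in> N s \<inter> ?S" for s y
      using inj_onD[OF inj, of y s] that N_irrefl by blast
    show "inj_on \<phi> (N u \<inter> ?S)" for u using inj by (rule inj_on_subset) auto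
    have "conflict_free \<phi> (N a)" by (rule pair[OF _ NS(1)]) (use dist \<phi> ne in auto)
    moreover have "conflict_free \<phi> (N b)" by (rule pair[OF _ NS(2)]) (use dist \<phi> ne in auto)
    moreover have "conflict_free \<phi> (N c)" by (rule pair[OF _ NS(3)]) (use dist \<phi> ne in auto)
    ultimately show "conflict_free \<phi> (N s)" if "s \<in> ?S" for s using that by blast
  qed (rule \<phi>(4))
  then show ?thesis by blast
qed

lemma partial_colouring_quadrilateral:
  assumes T: "component T" and no_triangle: "\<And>x y z. x \<in> T \<Longrightarrow> y \<in> N x \<Longrightarrow> z \<in> N y \<Longrightarrow> x \<notin> N z"
    and abcd: "a \<in> T" "b \<in> N a" "c \<in> N b" "d \<in> N c" "a \<in> N d" "a \<noteq> c" "b \<noteq> d"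
  shows "\<exists>\<phi>. partial_colouring T \<phi>"
proof -
  let ?S = "{a, b, c, d}"
  have Tc: "closed_set T" using T unfolding component_def by blast
  then have TV: "T \<subseteq> V" and TN: "\<And>x. x \<in> T \<Longrightarrow> N x \<subseteq> T" unfolding closed_set_def by blast+
  have ST: "?S \<subseteq> T" using TN abcd by blast
  have SV: "?S \<subseteq> V" using ST TV by auto
  have nb: "b \<in> N a" "d \<in> N a" "a \<in> N b" "c \<in> N b" "b \<in> N c" "d \<in> N c" "a \<in> N d" "c \<in> N d" using abcd N_sym by blast+
  have dist: "a \<noteq> b" "b \<noteq> c" "c \<noteq> d" "d \<noteq> a" using nb N_irrefl by auto
  have chord: "c \<notin> N a" "a \<notin> N c" "b \<notin> N d" "d \<notin> N b"
    using no_triangle[of a c b] no_triangle[of c a b] no_triangle[of b d a] no_triangle[of d b a] nb N_sym ST by blast+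
  have "N s \<inter> ?S \<noteq> {}" if "s \<in> ?S" for s using that nb by blast
  then obtain \<psi> where \<psi>: "partial_colouring (T - ?S) \<psi>" using greedy_colouring[OF T ST] by blast
  obtain G where G: "avoidance ?S \<psi> G" using ex_avoidance by blast
  define R where "R = residual ?S \<psi> G"
  define Q where "Q s = \<psi> ` (N s - ?S)" for s
  have NS: "N a \<inter> ?S = {b, d}" "N b \<inter> ?S = {a, c}" "N c \<inter> ?S = {b, d}" "N d \<inter> ?S = {a, c}"
    using nb N_irrefl chord by auto
  have "card (N s - ?S) + 2 = card (N s)" if "N s \<inter> ?S = {x, y}" "x \<noteq> y" for s x y
    using card_Int_Diff[OF finite_N[of s], of ?S] that(2) unfolding that(1) by simp
  from this[OF NS(1)] this[OF NS(2)] this[OF NS(3)] this[OF NS(4)]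
  have card_out: "card (N s - ?S) + 2 = card (N s)" if "s \<in> ?S" for s using that abcd(6,7) by blast
  have card_out_le: "card (N s - ?S) \<le> 2" if "s \<in> ?S" for s using card_out[OF that] card_N[of s] by linarith
  define f where "f \<longleftrightarrow> (\<exists>u\<in>T - ?S. a \<in> N u \<and> c \<in> N u \<and> G u = {})"
  define g where "g \<longleftrightarrow> (\<exists>u\<in>T - ?S. b \<in> N u \<and> d \<in> N u \<and> G u = {})"
  have size: "quad_list_size (R s) (Q s) h" if s: "s \<in> ?S" and h: "h \<Longrightarrow> \<exists>u\<in>N s - ?S. G u = {}" for s h
  proof -
    have fin: "finite (N s - ?S)" using finite_N by simp
    have Q: "card (Q s) \<le> 2" unfolding Q_def using card_image_le[OF fin, of \<psi>] card_out_le[OF s] by linarith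
    have "card {u \<in> N s - ?S. G u \<noteq> {}} + (if h then 1 else 0) \<le> card (N s - ?S)"
    proof (cases h)
      case True
      then have "card {u \<in> N s - ?S. G u \<noteq> {}} < card (N s - ?S)" using h fin by (intro psubset_card_mono) auto
      then show ?thesis using True by simp
    next
      case False
      then show ?thesis using fin by (auto intro: card_mono)
    qed
    moreover have "card (N s) + 3 \<le> card (R s) + card (Q s) + card {u \<in> N s - ?S. G u \<noteq> {}}"
      unfolding R_def Q_def using SV s by (intro card_residual[OF G]) auto
    ultimately have "(if h then 6 else 5) \<le> card (R s) + card (Q s)" using card_out[OF s] by (auto split: if_splits)
    moreover have "finite (Q s)" unfolding Q_def using fin by simp
    moreover have "R s \<inter> Q s = {}" unfolding R_def Q_def residual_def by blast
    ultimately show ?thesis unfolding quad_list_size_def using Q by blast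
  qed
  have "quad_list_size (R a) (Q a) f" by (rule size) (auto simp: f_def N_sym)
  moreover have "quad_list_size (R b) (Q b) g" by (rule size) (auto simp: g_def N_sym)
  moreover have "quad_list_size (R c) (Q c) f" by (rule size) (auto simp: f_def N_sym)
  moreover have "quad_list_size (R d) (Q d) g" by (rule size) (auto simp: g_def N_sym)
  ultimately obtain \<alpha> \<beta> \<gamma> \<delta> where col: "\<alpha> \<in> R a" "\<beta> \<in> R b" "\<gamma> \<in> R c" "\<delta> \<in> R d"
    and ok: "quad_ok \<alpha> \<beta> \<gamma> \<delta> (Q a) (Q b) (Q c) (Q d) f g"
    using quad_lists by metis
  define \<phi> where "\<phi> = \<psi>(a := \<alpha>, b := \<beta>, c := \<gamma>, d := \<delta>)"
  have \<phi>: "\<phi> a = \<alpha>" "\<phi> b = \<beta>" "\<phi> c = \<gamma>" "\<phi> d = \<delta>" "\<And>x. x \<notin> ?S \<Longrightarrow> \<phi> x = \<psi> x"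
    using dist abcd(6,7) by (auto simp: \<phi>_def)
  have im: "\<phi> ` (N s - ?S) = Q s" for s unfolding Q_def using \<phi>(5) by (intro image_cong) auto
  have pair: "conflict_free \<phi> (N s)" 
    if "s \<in> ?S" "N s \<inter> ?S = {x, y}" "x \<noteq> y" "{\<phi> x, \<phi> y} \<noteq> Q s" "card (Q s) \<le> 1 \<Longrightarrow> \<phi> x \<noteq> \<phi> y" for s x y
  proof -
    have xy: "x \<in> ?S" "y \<in> ?S" using that by blast+
    have "card (Q s) \<le> 2" using size[OF that(1), of False] unfolding quad_list_size_def by simp
    then have "\<phi> x \<noteq> \<phi> y \<or> x \<noteq> y \<and> card (Q s) = 2" using that(3,5) by linarith
    then have "conflict_free \<phi> (N s - ?S \<union> {x, y})"
      using xy that card_out_le[OF that(1)] finite_N im by (intro conflict_free_Un_pair) auto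
    moreover have "N s - ?S \<union> {x, y} = N s" using that(2) by blast
    ultimately show ?thesis by simp
  qed
  have "partial_colouring T \<phi>"
  proof (rule residual_extend[OF \<psi> Tc ST G])
    show "\<phi> s \<in> residual ?S \<psi> G s" if "s \<in> ?S" for s using that \<phi> col unfolding R_def by auto
    show "\<phi> y \<noteq> \<phi> s" if "s \<in> ?S" "y \<in> N s \<inter> ?S" for s y
    proof -
      have "\<phi> a \<noteq> \<phi> b" "\<phi> b \<noteq> \<phi> c" "\<phi> c \<noteq> \<phi> d" "\<phi> d \<noteq> \<phi> a" using ok \<phi> unfolding quad_ok_def by simp_all
      moreover have "s = a \<and> y \<in> {b, d} \<or> s = b \<and> y \<in> {a, c} \<or> s = c \<and> y \<in> {b, d} \<or> s = d \<and> y \<in> {a, c}"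
        using that NS by blast
      ultimately show ?thesis by fastforce
    qed
    show "inj_on \<phi> (N u \<inter> ?S)" if u: "u \<in> T - ?S" "G u = {}" for u
    proof (rule inj_onI)
      fix x y assume xy: "x \<in> N u \<inter> ?S" "y \<in> N u \<inter> ?S" "\<phi> x = \<phi> y"
      \<comment> \<open>Two neighbours of one vertex are nonadjacent without triangles, so if they
        lie on the 4-cycle and are distinct they are opposite, and the flags \<open>f\<close> and
        \<open>g\<close> apply.\<close>
      have nx: "x \<notin> N y" "y \<notin> N x"
        using no_triangle[of u y x] no_triangle[of u x y] xy u N_sym by blast+
      show "x = y"
      proof (rule ccontr)
        assume "x \<noteq> y"
        then consider "{x, y} = {a, c}" | "{x, y} = {b, d}" using xy nx nb by blast
        then show False
        proof cases
          case 1
          then have f using u xy unfolding f_def by (auto simp: doubleton_eq_iff)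
          then have "\<alpha> \<noteq> \<gamma>" using ok unfolding quad_ok_def by blast
          then show False using 1 xy(3) \<phi>(1,3) by (auto simp: doubleton_eq_iff)
        next
          case 2
          then have g using u xy unfolding g_def by (auto simp: doubleton_eq_iff)
          then have "\<beta> \<noteq> \<delta>" using ok unfolding quad_ok_def by blast
          then show False using 2 xy(3) \<phi>(2,4) by (auto simp: doubleton_eq_iff)
        qed
      qed
    qed
    have "conflict_free \<phi> (N a)" by (rule pair[OF _ NS(1)]) (use abcd(6,7) \<phi> ok in \<open>auto simp: quad_ok_def\<close>)
    moreover have "conflict_free \<phi> (N b)" by (rule pair[OF _ NS(2)]) (use abcd(6,7) \<phi> ok in \<open>auto simp: quad_ok_def\<close>)
    moreover have "conflict_free \<phi> (N c)" by (rule pair[OF _ NS(3)]) (use abcd(6,7) \<phi> ok in \<open>auto simp: quad_ok_def\<close>)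
    moreover have "conflict_free \<phi> (N d)" by (rule pair[OF _ NS(4)]) (use abcd(6,7) \<phi> ok in \<open>auto simp: quad_ok_def\<close>)
    ultimately show "conflict_free \<phi> (N s)" if "s \<in> ?S" for s using that by blast
  qed (rule \<phi>(5))
  then show ?thesis by blast
qed

section \<open>Components of girth at least 5\<close>

lemma finite_forbidden_N_Diff: "finite (forbidden \<psi> (N s - A))"
  by (intro finite_forbidden finite_Diff finite_N)

lemma card_forbidden_N_Diff: "t \<in> N s \<Longrightarrow> card (forbidden \<psi> (N s - {t})) \<le> 1"
  by (intro card_forbidden_le finite_Diff finite_N card_N_Diff_le)

text \<open>The colours that a neighbour \<open>x\<close> of \<open>v\<close> may take while
  \<open>v\<close> is uncoloured: they clash with no other neighbour of \<open>x\<close> and spoil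
  no neighbourhood centred at one. They do not depend on the present colour of
  \<open>x\<close>.\<close>

definition candidates :: "('a \<Rightarrow> 'c) \<Rightarrow> 'a \<Rightarrow> 'a \<Rightarrow> 'c set" where
  "candidates \<psi> v x = L x - \<psi> ` (N x - {v}) - (\<Union>w\<in>N x - {v}. forbidden \<psi> (N w - {x}))"

lemma card_candidates:
  assumes "x \<in> V" "v \<in> N x"
  shows "4 \<le> card (candidates \<psi> v x) + card (\<psi> ` (N x - {v}))"
proof -
  have f: "finite (N x - {v})" using finite_N by simp
  have F1: "card (forbidden \<psi> (N w - {x})) \<le> 1" if "w \<in> N x - {v}" for w
    using that N_sym by (intro card_forbidden_N_Diff) auto
  have "card (\<Union>w\<in>N x - {v}. forbidden \<psi> (N w - {x})) \<le> card (N x) - 1"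
    using card_UN_le_card'[OF f F1] card_N_Diff[OF assms(2)] by simp
  moreover have "card (L x) - card (\<psi> ` (N x - {v})) \<le> card (L x - \<psi> ` (N x - {v}))"
    using f by (intro diff_card_le_card_Diff) simp
  moreover have "card (L x - \<psi> ` (N x - {v})) - card (\<Union>w\<in>N x - {v}. forbidden \<psi> (N w - {x})) \<le> card (candidates \<psi> v x)"
    unfolding candidates_def using f finite_forbidden_N_Diff by (intro diff_card_le_card_Diff) auto
  ultimately show ?thesis using card_L[OF assms(1)] card_N_pos[OF assms(2)] by linarith
qed

lemma card_image_N_Diff: "v \<in> N x \<Longrightarrow> card (\<psi> ` (N x - {v})) \<le> 3"
  using card_image_le[of "N x - {v}" \<psi>] finite_N card_N_Diff_le[of v x] by force

lemma forbidden_or_candidates: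
  assumes "x \<in> V" "v \<in> N x"
  shows "forbidden \<psi> (N x - {v}) = {} \<or> 2 \<le> card (candidates \<psi> v x)"
proof (rule disjCI)
  assume n: "\<not> 2 \<le> card (candidates \<psi> v x)"
  have "\<not> card (\<psi> ` (N x - {v})) \<le> 2" using n card_candidates[OF assms, of \<psi>] by linarith
  then show "forbidden \<psi> (N x - {v}) = {}"
    using card_image_le_2_if_forbidden card_N_Diff_le[OF assms(2)] finite_N by (metis finite_Diff)
qed

text \<open>Without common neighbours of \<open>v\<close> and \<open>r\<close>, every neighbourhood
  meeting the edge contains just one end, so the colours forbidden by the rest decide. That of
  \<open>v\<close> is a hypothesis because it is secured in two ways: by the colour of
  \<open>r\<close>, or by another neighbour of \<open>v\<close>.\<close>

lemma edge_extend:
  assumes \<psi>: "partial_colouring (T - {v, r}) \<psi>" and T: "closed_set T" "v \<in> T" "r \<in> N v" "N v \<inter> N r = {}"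
    and a: "a \<in> L v" "a \<notin> \<psi> ` (N v - {r})" "a \<notin> forbidden \<psi> (N r - {v})"
    and b: "b \<in> L r" "b \<notin> \<psi> ` (N r - {v})" "a \<noteq> b"
    and cf: "conflict_free (\<psi>(v := a, r := b)) (N v)"
    and x: "\<And>x. x \<in> N v - {r} \<Longrightarrow> a \<notin> forbidden \<psi> (N x - {v})"
    and y: "\<And>y. y \<in> N r - {v} \<Longrightarrow> b \<notin> forbidden \<psi> (N y - {r})"
  shows "\<exists>\<phi>. partial_colouring T \<phi>"
proof -
  let ?\<phi> = "\<psi>(v := a, r := b)"
  have vr: "v \<in> N r" "v \<noteq> r" "v \<notin> N v" "r \<notin> N r" using T N_sym N_irrefl by auto
  have cf': "conflict_free ?\<phi> (N u)"
    if u: "s \<in> N u" "t \<notin> N u" "{s, t} = {v, r}" "?\<phi> s \<notin> forbidden \<psi> (N u - {s})" for u s t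
  proof -
    have "conflict_free ?\<phi> (insert s (N u - {s}))"
      using u by (intro conflict_free_insert[of _ _ \<psi>]) (auto simp: doubleton_eq_iff)
    then show ?thesis using u(1) by (simp add: insert_absorb)
  qed
  have "partial_colouring T ?\<phi>"
  proof (rule partial_colouring_extend[OF \<psi> _ T(1)])
    show "?\<phi> s \<in> L s" if "s \<in> {v, r}" for s using that a b by auto
    show "?\<phi> y \<noteq> ?\<phi> s" if "s \<in> {v, r}" "y \<in> N s" for s y
      using that a b vr by auto
    fix u assume u: "u \<in> T" "N u \<inter> {v, r} \<noteq> {}"
    then consider "u = v" | "u = r" | "u \<in> N v - {r}" | "u \<in> N r - {v}" using N_sym by blast
    then show "conflict_free ?\<phi> (N u)"
    proof cases
      case 1 then show ?thesis using cf by simp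
    next
      case 2 then show ?thesis using cf'[of v r r] vr a by auto
    next
      case 3
      then have "v \<in> N u" "r \<notin> N u" using T(4) N_sym by blast+
      then show ?thesis using cf'[of v u r] vr x 3 by auto
    next
      case 4
      then have "r \<in> N u" "v \<notin> N u" using T(4) N_sym by blast+
      then show ?thesis using cf'[of r u v] vr y 4 by auto
    qed
  qed simp
  then show ?thesis by blast
qed

lemma rigid_edge_extend:
  assumes \<psi>: "partial_colouring (T - {v, r}) \<psi>" and T: "closed_set T" "v \<in> T" "r \<in> N v" "N v \<inter> N r = {}"
    and x: "\<And>x. x \<in> N v - {r} \<Longrightarrow> forbidden \<psi> (N x - {v}) = {}"
    and y: "\<And>y. y \<in> N r - {v} \<Longrightarrow> forbidden \<psi> (N y - {r}) = {}"
  shows "\<exists>\<phi>. partial_colouring T \<phi>"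
proof -
  have vr: "v \<in> N r" using T N_sym by blast
  have V: "v \<in> V" "r \<in> V" using N_subset T vr by blast+
  have ge: "4 \<le> card (L s - \<psi> ` (N s - {t}))" if "s \<in> V" "t \<in> N s" for s t
  proof -
    have "card (\<psi> ` (N s - {t})) \<le> card (N s) - 1"
      using card_image_le[of "N s - {t}" \<psi>] finite_N card_N_Diff[OF that(2)] by simp
    then show ?thesis using card_L[OF that(1)] card_N_pos[OF that(2)] finite_N
        diff_card_le_card_Diff[of "\<psi> ` (N s - {t})" "L s"] by simp
  qed
  have "card (forbidden \<psi> (N r - {v})) < card (L v - \<psi> ` (N v - {r}))"
    using ge[OF V(1) T(3)] card_forbidden_N_Diff[OF vr, of \<psi>] by linarith
  then obtain a where a: "a \<in> L v - \<psi> ` (N v - {r})" "a \<notin> forbidden \<psi> (N r - {v})"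
    using ex_notin_of_card_less[OF finite_forbidden_N_Diff] by blast
  have "card (insert a (forbidden \<psi> (N v - {r}))) \<le> 2"
    using card_forbidden_N_Diff[OF T(3), of \<psi>] card_insert_le_m1[of 2] by simp
  then have "card (insert a (forbidden \<psi> (N v - {r}))) < card (L r - \<psi> ` (N r - {v}))"
    using ge[OF V(2) vr] by linarith
  then obtain b where b: "b \<in> L r - \<psi> ` (N r - {v})" "b \<notin> insert a (forbidden \<psi> (N v - {r}))"
    by (rule ex_notin_of_card_less[OF finite.insertI[OF finite_forbidden_N_Diff], THEN bexE])
  have "conflict_free (\<psi>(v := a, r := b)) (insert r (N v - {r}))"
    using b N_irrefl by (intro conflict_free_insert[of _ _ \<psi>]) auto
  then have "conflict_free (\<psi>(v := a, r := b)) (N v)" using T(3) by (simp add: insert_absorb)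
  then show ?thesis using a b x y by (intro edge_extend[OF \<psi> T, of a b]) auto
qed

text \<open>The neighbours of \<open>v\<close> can change simultaneously: they are pairwise
  nonadjacent, and a vertex other than \<open>v\<close> sees at most one of them. So candidates
  computed from the old colouring stay valid.\<close>

lemma recolour_neighbours:
  assumes \<psi>: "partial_colouring (T - {v, r}) \<psi>" and r: "r \<in> N v"
    and no_triangle: "\<And>y z. y \<in> N v \<Longrightarrow> z \<in> N y \<Longrightarrow> v \<notin> N z"
    and no_quadrilateral: "\<And>x y z. x \<in> N v \<Longrightarrow> y \<in> N x \<Longrightarrow> z \<in> N y \<Longrightarrow> v \<in> N z \<Longrightarrow> v \<noteq> y \<Longrightarrow> x = z"
    and \<psi>': "\<And>x. x \<notin> N v - {r} \<Longrightarrow> \<psi>' x = \<psi> x" "\<And>x. x \<in> N v - {r} \<Longrightarrow> \<psi>' x \<in> candidates \<psi> v x"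
  shows "partial_colouring (T - {v, r}) \<psi>'"
proof -
  let ?X = "N v - {r}"
  have X_indep: "y \<notin> ?X" if "x \<in> ?X" "y \<in> N x" for x y using that no_triangle N_sym by blast
  have new: "\<psi>' y \<noteq> \<psi>' x" if "x \<in> ?X" "y \<in> N x" "y \<noteq> v" for x y
  proof -
    have "\<psi>' x \<notin> \<psi> ` (N x - {v})" using \<psi>'(2)[OF that(1)] unfolding candidates_def by blast
    moreover have "\<psi> y \<in> \<psi> ` (N x - {v})" using that by blast
    ultimately show ?thesis using \<psi>'(1)[OF X_indep[OF that(1,2)]] by metis
  qed
  have "\<psi>' z \<in> L z \<and> (\<forall>y\<in>N z \<inter> (T - {v, r}). \<psi>' y \<noteq> \<psi>' z)" if z: "z \<in> T - {v, r}" for z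
  proof (cases "z \<in> ?X")
    case True
    then show ?thesis using \<psi>'(2)[OF True] new[OF True] unfolding candidates_def by blast
  next
    case False
    have "\<psi>' y \<noteq> \<psi>' z" if y: "y \<in> N z \<inter> (T - {v, r})" for y
    proof (cases "y \<in> ?X")
      case True
      have "z \<in> N y" "z \<noteq> v" using y z N_sym by blast+
      then show ?thesis using new[OF True] by metis
    next
      case False
      then show ?thesis using \<psi>'(1) \<open>z \<notin> ?X\<close> \<psi> z y unfolding partial_colouring_def by auto
    qed
    moreover have "\<psi>' z \<in> L z" using \<psi>'(1)[OF False] \<psi> z unfolding partial_colouring_def by auto
    ultimately show ?thesis by blast
  qed
  moreover have "conflict_free \<psi>' (N u)" if u: "u \<in> V" "N u \<subseteq> T - {v, r}" for u
  proof (cases "N u \<inter> ?X = {}")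
    case True
    have "conflict_free \<psi> (N u)" using \<psi> u unfolding partial_colouring_def by blast
    moreover have "\<psi>' w = \<psi> w" if "w \<in> N u" for w using that True \<psi>'(1) by blast
    ultimately show ?thesis using conflict_free_cong[of "N u" \<psi>' \<psi>] by blast
  next
    case False
    then obtain x where x: "x \<in> N u" "x \<in> ?X" by blast
    have uv: "u \<noteq> v" using u r by blast
    have ux: "u \<in> N x" using x N_sym by blast
    have "w \<notin> ?X" if w: "w \<in> N u - {x}" for w
      using no_quadrilateral[of x u w] ux uv x w N_sym by blast
    then have agree: "\<psi>' w = \<psi> w" if "w \<in> N u - {x}" for w using that \<psi>'(1) by blast
    have "\<psi>' x \<notin> forbidden \<psi> (N u - {x})" using \<psi>'(2)[OF x(2)] ux uv unfolding candidates_def by blast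
    then have "conflict_free \<psi>' (insert x (N u - {x}))" using agree by (intro conflict_free_insert) auto
    then show ?thesis using x(1) by (simp add: insert_absorb)
  qed
  ultimately show ?thesis unfolding partial_colouring_def by blast
qed

text \<open>A neighbour \<open>x\<close> of \<open>v\<close> excludes a single colour at \<open>v\<close>: its only candidate, or the colour forbidden by its
  neighbourhood, in which case it keeps a candidate besides the colour of \<open>v\<close>. The vertex \<open>x1\<close> is coloured
  last and makes the neighbourhood of \<open>v\<close> conflict-free whatever the colour of \<open>r\<close> is.\<close>

lemma flexible_edge_extend:
  assumes \<psi>: "partial_colouring (T - {v, r}) \<psi>" and T: "closed_set T" "v \<in> T" and r: "r \<in> N v"
    and no_triangle: "\<And>y z. y \<in> N v \<Longrightarrow> z \<in> N y \<Longrightarrow> v \<notin> N z"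
    and no_quadrilateral: "\<And>x y z. x \<in> N v \<Longrightarrow> y \<in> N x \<Longrightarrow> z \<in> N y \<Longrightarrow> v \<in> N z \<Longrightarrow> v \<noteq> y \<Longrightarrow> x = z"
    and x1: "x1 \<in> N v - {r}" "2 \<le> card (candidates \<psi> v x1)"
  shows "\<exists>\<phi>. partial_colouring T \<phi>"
proof -
  let ?X = "N v - {r}"
  define C where "C = candidates \<psi> v"
  have vr: "v \<in> N r" using r N_sym by blast
  have V: "v \<in> V" "r \<in> V" using N_subset r vr by blast+
  have fX: "finite ?X" using finite_N by simp
  have xv: "x \<in> V" "v \<in> N x" if "x \<in> ?X" for x using that N_subset N_sym by blast+
  have C_pos: "1 \<le> card (C x)" if "x \<in> ?X" for x
    unfolding C_def using card_candidates[of x v \<psi>] card_image_N_Diff[of v x \<psi>] xv[OF that] by linarith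

  define g where "g x = (if 2 \<le> card (C x) then forbidden \<psi> (N x - {v}) else C x)" for x
  have g1: "card (g x) \<le> 1" "finite (g x)" if "x \<in> ?X" for x
    using card_forbidden_N_Diff[OF xv(2)[OF that], of \<psi>] finite_forbidden_N_Diff C_pos[OF that]
    unfolding g_def by (auto intro: card_ge_0_finite)
  define A where "A = L v - (\<Union>x\<in>?X. g x)"
  have "card (\<Union>x\<in>?X. g x) \<le> card ?X" using fX g1 by (intro card_UN_le_card')
  then have A4: "4 \<le> card A"
    using diff_card_le_card_Diff[of "\<Union>x\<in>?X. g x" "L v"] fX g1 card_L[OF V(1)] card_N_Diff[OF r] card_N_pos[OF r]
    unfolding A_def by simp
  \<comment> \<open>Two options for \<open>v\<close> are kept in reserve for the choice at
    \<open>r\<close>. Either \<open>x1\<close> has exactly two candidates, and two of the four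
    colours of \<open>A\<close> avoid both, or it has more and can lose any one.\<close>
  have "\<exists>a a'. a \<in> A \<and> a' \<in> A \<and> a \<noteq> a' \<and> 2 \<le> card (C x1 - {a}) \<and> 2 \<le> card (C x1 - {a'})"
  proof (cases "card (C x1) = 2")
    case True
    then have "finite (C x1)" by (simp add: card_ge_0_finite)
    then have "2 \<le> card (A - C x1)" using A4 True by (intro card_Diff_ge) auto
    then obtain a a' where aa: "a \<in> A - C x1" "a' \<in> A - C x1" "a \<noteq> a'" using card_2_cases by blast
    then have "C x1 - {a} = C x1" "C x1 - {a'} = C x1" by auto
    then show ?thesis using aa True by (metis DiffD1 order_refl)
  next
    case False
    then have "2 \<le> card (C x1 - {a})" for a using x1(2) card_Diff_ge[of "{a}" 1 2 "C x1"] unfolding C_def by auto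
    moreover obtain a a' where "a \<in> A" "a' \<in> A" "a \<noteq> a'" using card_2_cases[of A] A4 by auto
    ultimately show ?thesis by blast
  qed
  then obtain a1 a2 where a12: "a1 \<in> A" "a2 \<in> A" "a1 \<noteq> a2" "2 \<le> card (C x1 - {a1})" "2 \<le> card (C x1 - {a2})" by blast

  define B where "B = candidates \<psi> v r"
  define P where "P = forbidden \<psi> (N r - {v})"
  have P: "finite P" "card P \<le> 1"
    unfolding P_def using finite_forbidden_N_Diff card_forbidden_N_Diff[OF vr] by blast+
  have B1: "1 \<le> card B"
    unfolding B_def using card_candidates[OF V(2) vr, of \<psi>] card_image_N_Diff[OF vr, of \<psi>] by linarith
  \<comment> \<open>If the neighbourhood of \<open>r\<close> forbids a colour at \<open>v\<close>,
    it may exclude one of the two options, but then \<open>r\<close> has two candidates and can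
    avoid the other. If it forbids none, a single candidate \<open>b\<close> still leaves one option
    different from it.\<close>
  have "\<exists>a b. a \<in> {a1, a2} \<and> a \<notin> P \<and> b \<in> B \<and> a \<noteq> b"
  proof (cases "P = {}")
    case True
    obtain b where "b \<in> B" using B1 by fastforce
    then show ?thesis using True a12(3) by blast
  next
    case False
    then have "2 \<le> card B" using forbidden_or_candidates[OF V(2) vr, of \<psi>] unfolding B_def P_def by blast
    moreover have "card P < card {a1, a2}" using P(2) a12(3) by simp
    then obtain a where "a \<in> {a1, a2}" "a \<notin> P" using ex_notin_of_card_less[OF P(1)] by blast
    ultimately show ?thesis using ex_avoid1[of B a] by metis
  qed
  then obtain a b where ab: "a \<in> A" "2 \<le> card (C x1 - {a})" "a \<notin> P" "b \<in> B" "a \<noteq> b" using a12 by blast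

  have "\<exists>c. c \<in> C x - {a}" if "x \<in> ?X" for x
  proof (cases "2 \<le> card (C x)")
    case True
    then show ?thesis using ex_avoid1[of "C x" a] by blast
  next
    case False
    then have "a \<notin> C x" using ab(1) that unfolding A_def g_def by auto
    moreover have "C x \<noteq> {}" using C_pos[OF that] by auto
    ultimately show ?thesis by blast
  qed
  then obtain \<chi> where \<chi>: "\<And>x. x \<in> ?X \<Longrightarrow> \<chi> x \<in> C x - {a}" by metis
  \<comment> \<open>On the neighbours of \<open>v\<close> other than \<open>x1\<close>,
    \<open>\<rho>\<close> gives the final colours. At most one colour is forbidden at
    \<open>x1\<close> by them, and \<open>x1\<close> has two candidates besides
    \<open>a\<close>.\<close>
  define \<rho> where "\<rho> = \<chi>(r := b)"
  define F where "F = forbidden \<rho> (N v - {x1})"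
  have "x1 \<in> N v" "x1 \<noteq> r" using x1 by auto
  then have "finite F" "card F \<le> 1"
    unfolding F_def using finite_forbidden_N_Diff card_forbidden_N_Diff by blast+
  then obtain c where c: "c \<in> C x1 - {a}" "c \<notin> F" using ex_notin_of_card_less[of F "C x1 - {a}"] ab(2) by auto
  define \<psi>' where "\<psi>' x = (if x = x1 then c else if x \<in> ?X then \<chi> x else \<psi> x)" for x
  have \<psi>'_out: "\<psi>' x = \<psi> x" if "x \<notin> ?X" for x using that x1 unfolding \<psi>'_def by auto
  have \<psi>'_in: "\<psi>' x \<in> C x - {a}" if "x \<in> ?X" for x using that \<chi> c unfolding \<psi>'_def by auto
  have \<psi>': "partial_colouring (T - {v, r}) \<psi>'"
    using \<psi>'_out \<psi>'_in unfolding C_def by (intro recolour_neighbours[OF \<psi> r no_triangle no_quadrilateral]) auto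
  have vNv: "v \<notin> N v" "r \<notin> N r" using N_irrefl by auto
  have "conflict_free (\<psi>'(v := a, r := b)) (insert x1 (N v - {x1}))"
  proof (rule conflict_free_insert[of _ _ \<rho>])
    fix w assume "w \<in> N v - {x1}"
    then show "(\<psi>'(v := a, r := b)) w = \<rho> w" using vNv unfolding \<rho>_def \<psi>'_def by auto
  next
    have "(\<psi>'(v := a, r := b)) x1 = c" using x1 vNv unfolding \<psi>'_def by auto
    then show "(\<psi>'(v := a, r := b)) x1 \<notin> forbidden \<rho> (N v - {x1})" using c unfolding F_def by simp
  qed simp
  then have cf: "conflict_free (\<psi>'(v := a, r := b)) (N v)" using \<open>x1 \<in> N v\<close> by (simp add: insert_absorb)
  have disj: "N v \<inter> N r = {}" using no_triangle[OF r] N_sym by blast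
  \<comment> \<open>The recoloured vertices lie in no neighbourhood of \<open>r\<close>, of another
    recoloured vertex, or of a neighbour of \<open>r\<close> other than \<open>v\<close>; so the
    sets forbidden there are unchanged.\<close>
  have same: "forbidden \<psi>' (N u - {w}) = forbidden \<psi> (N u - {w})" if "N u \<inter> ?X = {}" for u w
    using that \<psi>'_out by (intro forbidden_cong) blast
  have Nr: "N r \<inter> ?X = {}" using disj by blast
  have Nx: "N x \<inter> ?X = {}" if "x \<in> ?X" for x using no_triangle that N_sym by blast
  have Ny: "N y \<inter> ?X = {}" if "y \<in> N r - {v}" for y
    using no_quadrilateral[OF r, of y] that N_sym by blast
  show ?thesis
  proof (rule edge_extend[OF \<psi>' T r disj _ _ _ _ _ ab(5) cf])
    show "a \<in> L v" using ab unfolding A_def by blast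
    show "a \<notin> \<psi>' ` (N v - {r})" using \<psi>'_in by blast
    show "a \<notin> forbidden \<psi>' (N r - {v})" using ab(3) same[OF Nr] unfolding P_def by simp
    show "b \<in> L r" using ab(4) unfolding B_def candidates_def by blast
    have "\<psi>' ` (N r - {v}) = \<psi> ` (N r - {v})" using Nr \<psi>'_out by (intro image_cong) blast+
    then show "b \<notin> \<psi>' ` (N r - {v})" using ab(4) unfolding B_def candidates_def by simp
    show "a \<notin> forbidden \<psi>' (N x - {v})" if x: "x \<in> ?X" for x
    proof (cases "2 \<le> card (C x)")
      case True
      then show ?thesis using ab(1) x same[OF Nx[OF x]] unfolding A_def g_def by auto
    next
      case False
      then show ?thesis using forbidden_or_candidates[OF xv[OF x], of \<psi>] same[OF Nx[OF x]] unfolding C_def by simp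
    qed
    show "b \<notin> forbidden \<psi>' (N y - {r})" if y: "y \<in> N r - {v}" for y
      using ab(4) y same[OF Ny[OF y]] unfolding B_def candidates_def by auto
  qed
qed

lemma partial_colouring_girth_5:
  assumes T: "component T" and no_triangle: "\<And>x y z. x \<in> T \<Longrightarrow> y \<in> N x \<Longrightarrow> z \<in> N y \<Longrightarrow> x \<notin> N z"
    and no_quadrilateral: "\<And>v x y z. v \<in> T \<Longrightarrow> x \<in> N v \<Longrightarrow> y \<in> N x \<Longrightarrow> z \<in> N y \<Longrightarrow> v \<in> N z \<Longrightarrow> v \<noteq> y \<Longrightarrow> x = z"
    and vr: "v \<in> T" "r \<in> N v"
  shows "\<exists>\<phi>. partial_colouring T \<phi>"
proof -
  have Tc: "closed_set T" using T unfolding component_def by blast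
  then have TV: "T \<subseteq> V" and TN: "\<And>x. x \<in> T \<Longrightarrow> N x \<subseteq> T" unfolding closed_set_def by blast+
  have r: "r \<in> T" "v \<in> N r" using TN vr N_sym by blast+
  have "\<exists>\<psi>. partial_colouring (T - {v, r}) \<psi>"
    by (rule greedy_colouring[OF T]) (use vr r in auto)
  then obtain \<psi> where \<psi>: "partial_colouring (T - {v, r}) \<psi>" by blast
  then have \<psi>2: "partial_colouring (T - {r, v}) \<psi>" by (simp add: insert_commute)
  consider (v) x where "x \<in> N v - {r}" "2 \<le> card (candidates \<psi> v x)"
    | (r) y where "y \<in> N r - {v}" "2 \<le> card (candidates \<psi> r y)"
    | (n) "\<And>x. x \<in> N v - {r} \<Longrightarrow> \<not> 2 \<le> card (candidates \<psi> v x)" "\<And>y. y \<in> N r - {v} \<Longrightarrow> \<not> 2 \<le> card (candidates \<psi> r y)"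
    by blast
  then show ?thesis
  proof cases
    case v
    then show ?thesis
      by (rule flexible_edge_extend[OF \<psi> Tc vr, rotated 2])
        (use no_triangle[OF vr(1)] no_quadrilateral[OF vr(1)] in blast)+
  next
    case r': r
    then show ?thesis
      by (rule flexible_edge_extend[OF \<psi>2 Tc r, rotated 2])
        (use no_triangle[OF r(1)] no_quadrilateral[OF r(1)] in blast)+
  next
    case n
    have "x \<in> V" "v \<in> N x" if "x \<in> N v - {r}" for x using that N_subset N_sym by blast+
    then have x: "forbidden \<psi> (N x - {v}) = {}" if "x \<in> N v - {r}" for x
      using n(1) forbidden_or_candidates that by blast
    have "y \<in> V" "r \<in> N y" if "y \<in> N r - {v}" for y using that N_subset N_sym by blast+
    then have y: "forbidden \<psi> (N y - {r}) = {}" if "y \<in> N r - {v}" for y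
      using n(2) forbidden_or_candidates that by blast
    have "N v \<inter> N r = {}" using no_triangle[OF vr] N_sym by blast
    then show ?thesis by (rule rigid_edge_extend[OF \<psi> Tc vr _ x y])
  qed
qed

section \<open>The whole graph\<close>

lemma partial_colouring_component:
  assumes "component T"
  shows "\<exists>\<phi>. partial_colouring T \<phi>"
proof -
  have Tc: "closed_set T" and ne: "T \<noteq> {}"
    and min: "\<And>U. closed_set U \<Longrightarrow> U \<noteq> {} \<Longrightarrow> U \<subseteq> T \<Longrightarrow> U = T"
    using assms unfolding component_def by blast+
  obtain v where v: "v \<in> T" using ne by blast
  show ?thesis
  proof (cases "N v = {}")
    case True
    have "v \<in> V" using v Tc unfolding closed_set_def by blast
    then have "T = {v}" using min[of "{v}"] v True unfolding closed_set_def by simp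
    moreover obtain c where "c \<in> L v" using card_L[OF \<open>v \<in> V\<close>] by fastforce
    moreover have "N u = {}" if "N u \<subseteq> {v}" for u using that True N_sym by blast
    ultimately have "partial_colouring T (\<lambda>_. c)"
      using True unfolding partial_colouring_def conflict_free_def by auto
    then show ?thesis by blast
  next
    case False
    then obtain r where r: "r \<in> N v" by blast
    show ?thesis
    proof (cases "\<exists>a\<in>T. \<exists>b\<in>N a. \<exists>c\<in>N b. a \<in> N c")
      case True
      then show ?thesis using partial_colouring_triangle[OF assms] by blast
    next
      case False
      then have no_triangle: "x \<notin> N z" if "x \<in> T" "y \<in> N x" "z \<in> N y" for x y z using that by blast
      show ?thesis
      proof (cases "\<exists>a\<in>T. \<exists>b\<in>N a. \<exists>c\<in>N b. \<exists>d\<in>N c. a \<in> N d \<and> a \<noteq> c \<and> b \<noteq> d")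
        case True
        then obtain a b c d where "a \<in> T" "b \<in> N a" "c \<in> N b" "d \<in> N c" "a \<in> N d" "a \<noteq> c" "b \<noteq> d" by blast
        then show ?thesis
          by (rule partial_colouring_quadrilateral[OF assms, rotated]) (use no_triangle in blast)
      next
        case False
        then have no_quadrilateral: "x = z" if "u \<in> T" "x \<in> N u" "y \<in> N x" "z \<in> N y" "u \<in> N z" "u \<noteq> y" for u x y z
          using that by blast
        show ?thesis
          by (rule partial_colouring_girth_5[OF assms _ _ v r])
            (use no_triangle in blast, use no_quadrilateral in blast)
      qed
    qed
  qed
qed

lemma closed_set_Diff: "closed_set K \<Longrightarrow> closed_set T \<Longrightarrow> closed_set (K - T)"
  unfolding closed_set_def using N_sym by blast

lemma partial_colouring_closed_set:
  assumes "closed_set K"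
  shows "\<exists>\<phi>. partial_colouring K \<phi>"
proof -
  have "finite K" using assms finite_V unfolding closed_set_def by (auto intro: finite_subset)
  then show ?thesis using assms
  proof (induction K rule: finite_psubset_induct)
    case (psubset K)
    show ?case
    proof (cases "K = {}")
      case True
      then show ?thesis by (auto simp: partial_colouring_def conflict_free_def)
    next
      case False
      define \<A> where "\<A> = {U. closed_set U \<and> U \<noteq> {} \<and> U \<subseteq> K}"
      have "finite \<A>" using psubset.hyps by (auto simp: \<A>_def intro: finite_subset[of _ "Pow K"])
      moreover have "\<A> \<noteq> {}" using False psubset.prems by (auto simp: \<A>_def)
      ultimately obtain T where T: "T \<in> \<A>" "\<And>U. U \<in> \<A> \<Longrightarrow> U \<subseteq> T \<Longrightarrow> T = U"
        using finite_has_minimal[of \<A>] by blast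
      then have TK: "closed_set T" "T \<noteq> {}" "T \<subseteq> K" by (auto simp: \<A>_def)
      have "component T" unfolding component_def using T TK by (auto simp: \<A>_def)
      then obtain \<phi> where \<phi>: "partial_colouring T \<phi>" using partial_colouring_component by blast
      have "closed_set (K - T)" using psubset.prems TK(1) by (rule closed_set_Diff)
      moreover have "K - T \<subset> K" using TK by blast
      ultimately obtain \<psi> where \<psi>: "partial_colouring (K - T) \<psi>" using psubset.IH by blast
      have "partial_colouring K (\<lambda>x. if x \<in> T then \<phi> x else \<psi> x)"
      proof (rule partial_colouring_extend[OF \<psi> _ psubset.prems])
        fix s assume s: "s \<in> T"
        then have "N s \<subseteq> T" using TK(1) unfolding closed_set_def by blast
        then show "(if y \<in> T then \<phi> y else \<psi> y) \<noteq> (if s \<in> T then \<phi> s else \<psi> s)" if "y \<in> N s" for y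
          using that s \<phi> unfolding partial_colouring_def by auto
        show "(if s \<in> T then \<phi> s else \<psi> s) \<in> L s" using s \<phi> unfolding partial_colouring_def by auto
      next
        fix u assume u: "u \<in> K" "N u \<inter> T \<noteq> {}"
        then have "u \<in> T" using TK(1) N_sym unfolding closed_set_def by blast
        then have "N u \<subseteq> T" "u \<in> V" using TK(1) unfolding closed_set_def by auto
        then have "conflict_free \<phi> (N u)" using \<phi> unfolding partial_colouring_def by blast
        moreover have "(if w \<in> T then \<phi> w else \<psi> w) = \<phi> w" if "w \<in> N u" for w using that \<open>N u \<subseteq> T\<close> by auto
        ultimately show "conflict_free (\<lambda>x. if x \<in> T then \<phi> x else \<psi> x) (N u)"
          using conflict_free_cong[of "N u" "\<lambda>x. if x \<in> T then \<phi> x else \<psi> x" \<phi>] by blast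
      qed simp
      then show ?thesis by blast
    qed
  qed
qed

end

lemma ex_pcf_coloring:
  fixes L :: "'a \<Rightarrow> 'c set"
  assumes G: "simple_graph V E" and deg: "max_degree V E \<le> 4"
    and L: "list_assignment V (\<lambda>v. degree E v + 3) L"
  shows "\<exists>\<phi>. pcf_coloring V E L \<phi>"
proof -
  let ?N = "neighborhood E"
  have fV: "finite V" and edge: "\<And>e. e \<in> E \<Longrightarrow> e \<subseteq> V \<and> card e = 2" using G unfolding simple_graph_def by auto
  have sub: "?N x \<subseteq> V" for x using edge unfolding neighborhood_def by blast
  have sym: "x \<in> ?N y" if "y \<in> ?N x" for x y using that unfolding neighborhood_def by (simp add: insert_commute)
  have "card (?N x) \<le> 4" if "x \<in> V" for x
  proof -
    have "degree E x \<le> max_degree V E" unfolding max_degree_def using that fV by (intro Max_ge) auto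
    then show ?thesis using deg unfolding degree_def by linarith
  qed
  moreover have "?N x = {}" if "x \<notin> V" for x using that sub sym by blast
  ultimately have card_N: "card (?N x) \<le> 4" for x by (cases "x \<in> V") auto
  \<comment> \<open>Finite sublists replace infinite lists, on which \<open>card\<close> would be
    0.\<close>
  have "\<exists>M \<subseteq> L x. x \<in> V \<longrightarrow> card (?N x) + 3 \<le> card M" for x
  proof (cases "infinite (L x)")
    case True
    then show ?thesis using infinite_arbitrarily_large[of "L x" "card (?N x) + 3"] by (metis order_refl)
  next
    case False
    then show ?thesis using L unfolding list_assignment_def degree_def by blast
  qed
  then obtain M where M: "\<And>x. M x \<subseteq> L x" "\<And>x. x \<in> V \<Longrightarrow> card (?N x) + 3 \<le> card (M x)" by metis
  have "x \<notin> ?N x" for x using edge[of "{x, x}"] unfolding neighborhood_def by auto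
  then interpret list_graph V ?N M using fV sub sym card_N M(2) by unfold_locales
  have "closed_set V" unfolding closed_set_def using sub by blast
  then obtain \<phi> where \<phi>: "partial_colouring V \<phi>" using partial_colouring_closed_set by blast
  have "\<exists>c. \<exists>!w. w \<in> ?N v \<and> \<phi> w = c" if v: "v \<in> V" "?N v \<noteq> {}" for v
  proof -
    have "conflict_free \<phi> (?N v)" using \<phi> sub v(1) unfolding partial_colouring_def by blast
    then show ?thesis using v(2) unfolding conflict_free_def by blast
  qed
  moreover have "\<phi> v \<in> L v" if "v \<in> V" for v using that \<phi> M(1) unfolding partial_colouring_def by blast
  moreover have "\<phi> u \<noteq> \<phi> v" if "u \<in> V" "v \<in> V" "{u, v} \<in> E" for u v
  proof -
    have "v \<in> ?N u \<inter> V" using that unfolding neighborhood_def by simp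
    then show ?thesis using \<phi> that(1) unfolding partial_colouring_def by metis
  qed
  ultimately show ?thesis unfolding pcf_coloring_def by blast
qed

theorem theorem8:
  fixes V :: "'a set" and E :: "'a set set"
  assumes "simple_graph V E"
    and "max_degree V E \<le> 4"
  shows "pcf_degree_plus_choosable TYPE('c) V E 3 \<and> pcf_const_choosable TYPE('c) V E 7"
proof
  show "pcf_degree_plus_choosable TYPE('c) V E 3"
    unfolding pcf_degree_plus_choosable_def pcf_choosable_def using ex_pcf_coloring[OF assms] by blast
  have "degree E v \<le> 4" if "v \<in> V" for v
  proof -
    have "degree E v \<le> max_degree V E"
      unfolding max_degree_def using that assms(1) by (intro Max_ge) (auto simp: simple_graph_def)
    then show ?thesis using assms(2) by linarith
  qed
  then have "list_assignment V (\<lambda>v. degree E v + 3) L" if "list_assignment V (\<lambda>_. 7) L" for L :: "'a \<Rightarrow> 'c set"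
    using that unfolding list_assignment_def by fastforce
  then show "pcf_const_choosable TYPE('c) V E 7"
    unfolding pcf_const_choosable_def pcf_choosable_def using ex_pcf_coloring[OF assms] by blast
qed

end
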